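(* Let $M$ be an $\omega$-complete effect monoid. Then there exists a basically disconnected compact Hausdorff space $X$ and an $\omega$-complete Boolean algebra $B$ such that $M$ embeds into $[0,1]_{C(X)} \oplus B$.
   Context: An effect algebra is a set $E$ with an element $0$, a partial binary operation $a+b$ (the partial sum), and a total complement $a\mapsto a^\perp$, such that: the sum is commutative and associative wherever defined, $a+0=a$, $a^\perp$ is the unique element with $a+a^\perp=1$ where $1:=0^\perp$, and $a+1$ defined implies $a=0$. The order is $a\le b$ iff $b=a+c$ for some $c$. An effect monoid is an effect algebra with an associative total multiplication $\cdot$ with unit $1$ which distributes over the partial sum on both sides (if $b+c$ is defined, then $a\cdot b+a\cdot c$ and $b\cdot a+c\cdot a$ are defined and equal $a\cdot(b+c)$ and $(b+c)\cdot a$). It is $\omega$-complete if every increasing sequence has a supremum. $[0,1]_{C(X)}$ is the set of continuous functions $X\to[0,1]$, with $f+g$ defined iff $f+g\le 1$ pointwise, complement $1-f$, and pointwise multiplication. A Boolean algebra is an effect monoid with $x+y$ defined iff $x\wedge y=0$ (then equal to $x\vee y$), complement the Boolean complement, and product $x\wedge y$. The direct sum $\oplus$ is the Cartesian product with componentwise operations. An embedding of effect monoids is a map preserving $1$, the partial sum and the multiplication, which is order reflecting. A compact Hausdorff space is basically disconnected if every cozero set has open closure. *)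

theory Defs
  imports "HOL-Analysis.Analysis" "HOL-Algebra.Lattice"
begin

section \<open>Effect algebras and effect monoids\<close>

text \<open>
  The partial sum is option-valued: \<open>eplus E a b = Some c\<close> says that \<open>a + b\<close> is defined
  and equal to \<open>c\<close>. As usual for carrier-based structures, operations are unconstrained
  outside the carrier.
\<close>

record 'a effect_algebra = "'a partial_object" +
  ezero :: 'a
  eplus :: "'a \<Rightarrow> 'a \<Rightarrow> 'a option"
  ecompl :: "'a \<Rightarrow> 'a"

definition eone :: "('a, 'm) effect_algebra_scheme \<Rightarrow> 'a" where
  "eone E = ecompl E (ezero E)"

locale effect_algebra =
  fixes E :: "('a, 'm) effect_algebra_scheme" (structure)
  assumes zero_closed: "ezero E \<in> carrier E"
    and plus_closed:
      "\<lbrakk>a \<in> carrier E; b \<in> carrier E; eplus E a b = Some c\<rbrakk> \<Longrightarrow> c \<in> carrier E"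
    and compl_closed: "a \<in> carrier E \<Longrightarrow> ecompl E a \<in> carrier E"
    and plus_commute:
      "\<lbrakk>a \<in> carrier E; b \<in> carrier E\<rbrakk> \<Longrightarrow> eplus E a b = eplus E b a"
    and plus_assoc:
      "\<lbrakk>a \<in> carrier E; b \<in> carrier E; c \<in> carrier E;
        eplus E a b = Some d; eplus E d c = Some e\<rbrakk>
       \<Longrightarrow> \<exists>f. eplus E b c = Some f \<and> eplus E a f = Some e"
    and plus_zero: "a \<in> carrier E \<Longrightarrow> eplus E a (ezero E) = Some a"
    and plus_compl: "a \<in> carrier E \<Longrightarrow> eplus E a (ecompl E a) = Some (eone E)"
    and compl_unique:
      "\<lbrakk>a \<in> carrier E; b \<in> carrier E; eplus E a b = Some (eone E)\<rbrakk> \<Longrightarrow> b = ecompl E a"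
    and zero_one_law:
      "\<lbrakk>a \<in> carrier E; eplus E a (eone E) \<noteq> None\<rbrakk> \<Longrightarrow> a = ezero E"

definition effect_order :: "('a, 'm) effect_algebra_scheme \<Rightarrow> 'a gorder" where
  "effect_order E =
     \<lparr>carrier = carrier E, eq = (=),
      le = (\<lambda>a b. \<exists>c\<in>carrier E. eplus E a c = Some b)\<rparr>"

definition omega_complete :: "('a, 'm) effect_algebra_scheme \<Rightarrow> bool" where
  "omega_complete E \<longleftrightarrow>
     (\<forall>a :: nat \<Rightarrow> 'a.
        (\<forall>n. a n \<in> carrier E) \<longrightarrow>
        (\<forall>n. a n \<sqsubseteq>\<^bsub>effect_order E\<^esub> a (Suc n)) \<longrightarrow>
        (\<exists>s. is_lub (effect_order E) s (range a)))"

record 'a effect_monoid = "'a effect_algebra" +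
  emult :: "'a \<Rightarrow> 'a \<Rightarrow> 'a"

locale effect_monoid = effect_algebra M
  for M :: "('a, 'm) effect_monoid_scheme" (structure) +
  assumes mult_closed:
      "\<lbrakk>a \<in> carrier M; b \<in> carrier M\<rbrakk> \<Longrightarrow> emult M a b \<in> carrier M"
    and mult_assoc:
      "\<lbrakk>a \<in> carrier M; b \<in> carrier M; c \<in> carrier M\<rbrakk>
       \<Longrightarrow> emult M (emult M a b) c = emult M a (emult M b c)"
    and mult_one_left: "a \<in> carrier M \<Longrightarrow> emult M (eone M) a = a"
    and mult_one_right: "a \<in> carrier M \<Longrightarrow> emult M a (eone M) = a"
    and distrib_left:
      "\<lbrakk>a \<in> carrier M; b \<in> carrier M; c \<in> carrier M; eplus M b c = Some d\<rbrakk>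
       \<Longrightarrow> eplus M (emult M a b) (emult M a c) = Some (emult M a d)"
    and distrib_right:
      "\<lbrakk>a \<in> carrier M; b \<in> carrier M; c \<in> carrier M; eplus M b c = Some d\<rbrakk>
       \<Longrightarrow> eplus M (emult M b a) (emult M c a) = Some (emult M d a)"

definition direct_sum ::
  "('a, 'm) effect_monoid_scheme \<Rightarrow> ('b, 'n) effect_monoid_scheme \<Rightarrow> ('a \<times> 'b) effect_monoid"
where
  "direct_sum M N =
     \<lparr>carrier = carrier M \<times> carrier N,
      ezero = (ezero M, ezero N),
      eplus = (\<lambda>(a, b) (c, d).
        case (eplus M a c, eplus N b d) of (Some x, Some y) \<Rightarrow> Some (x, y) | _ \<Rightarrow> None),
      ecompl = (\<lambda>(a, b). (ecompl M a, ecompl N b)),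
      emult = (\<lambda>(a, b) (c, d). (emult M a c, emult N b d))\<rparr>"

lemma direct_sum_effect_monoid:
  assumes "effect_monoid M" "effect_monoid N"
  shows "effect_monoid (direct_sum M N)"
proof -
  interpret M: effect_monoid M by fact
  interpret N: effect_monoid N by fact
  have [simp]: "eone (direct_sum M N) = (eone M, eone N)"
    by (simp add: eone_def direct_sum_def)
  have s: "carrier (direct_sum M N) = carrier M \<times> carrier N"
    "ezero (direct_sum M N) = (ezero M, ezero N)"
    "\<And>a b c d. eplus (direct_sum M N) (a, b) (c, d) =
       (case (eplus M a c, eplus N b d) of (Some x, Some y) \<Rightarrow> Some (x, y) | _ \<Rightarrow> None)"
    "\<And>a b. ecompl (direct_sum M N) (a, b) = (ecompl M a, ecompl N b)"
    "\<And>a b c d. emult (direct_sum M N) (a, b) (c, d) = (emult M a c, emult N b d)"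
    by (simp_all add: direct_sum_def)
  show ?thesis
  proof (unfold_locales, goal_cases)
    case (5 a b c d e)
    obtain a1 a2 b1 b2 c1 c2 d1 d2 e1 e2 where
      [simp]: "a = (a1,a2)" "b = (b1,b2)" "c = (c1,c2)" "d = (d1,d2)" "e = (e1,e2)"
      by (metis surj_pair)
    from 5 have h: "a1 \<in> carrier M" "b1 \<in> carrier M" "c1 \<in> carrier M"
      "a2 \<in> carrier N" "b2 \<in> carrier N" "c2 \<in> carrier N"
      "eplus M a1 b1 = Some d1" "eplus M d1 c1 = Some e1"
      "eplus N a2 b2 = Some d2" "eplus N d2 c2 = Some e2"
      by (simp_all add: s split: option.splits)
    obtain f1 where "eplus M b1 c1 = Some f1" "eplus M a1 f1 = Some e1"
      using M.plus_assoc h by blast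
    moreover obtain f2 where "eplus N b2 c2 = Some f2" "eplus N a2 f2 = Some e2"
      using N.plus_assoc h by blast
    ultimately show ?case by (simp add: s)
  next
    case (8 a b) then show ?case
      by (auto simp: s split: option.splits intro: M.compl_unique N.compl_unique)
  next
    case (9 a) then show ?case
      using M.zero_one_law N.zero_one_law by (force simp: s split: option.splits)
  next
    case 2 then show ?case
      by (auto simp: s split: option.splits dest: M.plus_closed N.plus_closed)
  next
    case 4 then show ?case
      using M.plus_commute N.plus_commute by (fastforce simp: s)
  qed (auto simp: s M.zero_closed N.zero_closed
      M.compl_closed N.compl_closed M.plus_zero N.plus_zero
      M.plus_compl N.plus_compl M.mult_closed N.mult_closed M.mult_assoc N.mult_assoc
      M.mult_one_left N.mult_one_left M.mult_one_right N.mult_one_right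
      M.distrib_left N.distrib_left M.distrib_right N.distrib_right split: option.splits)
qed

locale effect_monoid_embedding =
  fixes M :: "('a, 'm) effect_monoid_scheme" and N :: "('b, 'n) effect_monoid_scheme"
    and f :: "'a \<Rightarrow> 'b"
  assumes map_closed: "a \<in> carrier M \<Longrightarrow> f a \<in> carrier N"
    and map_one: "f (eone M) = eone N"
    and map_plus:
      "\<lbrakk>a \<in> carrier M; b \<in> carrier M; eplus M a b = Some c\<rbrakk>
       \<Longrightarrow> eplus N (f a) (f b) = Some (f c)"
    and map_mult:
      "\<lbrakk>a \<in> carrier M; b \<in> carrier M\<rbrakk> \<Longrightarrow> f (emult M a b) = emult N (f a) (f b)"
    and order_reflecting:
      "\<lbrakk>a \<in> carrier M; b \<in> carrier M; f a \<sqsubseteq>\<^bsub>effect_order N\<^esub> f b\<rbrakk>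
       \<Longrightarrow> a \<sqsubseteq>\<^bsub>effect_order M\<^esub> b"


section \<open>The effect monoid of continuous functions into the unit interval\<close>

text \<open>
  Functions are taken to be \<^const>\<open>extensional\<close> on the underlying set of the space, so that
  equality in the carrier is pointwise equality on the space.
\<close>

definition unit_interval_C :: "'x topology \<Rightarrow> ('x \<Rightarrow> real) effect_monoid" where
  "unit_interval_C X =
     \<lparr>carrier = {f \<in> extensional (topspace X). continuous_map X (top_of_set {0..1}) f},
      ezero = (\<lambda>x\<in>topspace X. 0),
      eplus = (\<lambda>f g. if \<forall>x\<in>topspace X. f x + g x \<le> 1
                     then Some (\<lambda>x\<in>topspace X. f x + g x) else None),
      ecompl = (\<lambda>f. \<lambda>x\<in>topspace X. 1 - f x),
      emult = (\<lambda>f g. \<lambda>x\<in>topspace X. f x * g x)\<rparr>"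

lemma unit_interval_C_carrier:
  "f \<in> carrier (unit_interval_C X) \<longleftrightarrow> f \<in> extensional (topspace X) \<and>
   continuous_map X euclideanreal f \<and> (\<forall>x\<in>topspace X. 0 \<le> f x \<and> f x \<le> 1)"
  by (auto simp: unit_interval_C_def continuous_map_in_subtopology Pi_iff image_subset_iff)

lemma continuous_map_restrict_topspace:
  "continuous_map X Y f \<Longrightarrow> continuous_map X Y (\<lambda>x\<in>topspace X. f x)"
  by (rule continuous_map_eq[of X Y f]) auto

lemma unit_interval_C_effect_monoid: "effect_monoid (unit_interval_C X)"
proof -
  let ?C = "unit_interval_C X"
  note c = continuous_map_restrict_topspace continuous_map_const[THEN iffD2] continuous_map_add
    continuous_map_diff continuous_map_real_mult
  have one: "eone ?C = (\<lambda>x\<in>topspace X. 1)"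
    by (auto simp: eone_def unit_interval_C_def fun_eq_iff)
  have s: "ezero ?C = (\<lambda>x\<in>topspace X. 0)"
    "\<And>f g. eplus ?C f g = (if \<forall>x\<in>topspace X. f x + g x \<le> 1
                     then Some (\<lambda>x\<in>topspace X. f x + g x) else None)"
    "\<And>f. ecompl ?C f = (\<lambda>x\<in>topspace X. 1 - f x)"
    "\<And>f g. emult ?C f g = (\<lambda>x\<in>topspace X. f x * g x)"
    by (simp_all add: unit_interval_C_def)
  note e = extensionalityI[where A="topspace X"]
  show ?thesis
  proof (unfold_locales, goal_cases)
    case 1 then show ?case by (auto simp: unit_interval_C_carrier s intro!: c)
  next
    case 2 then show ?case by (auto simp: unit_interval_C_carrier s intro!: c split: if_splits)
  next
    case 3 then show ?case by (auto simp: unit_interval_C_carrier s intro!: c)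
  next
    case 4 then show ?case by (auto simp: s add.commute)
  next
    case (5 a b c d f)
    then have "b x + c x \<le> 1" if "x \<in> topspace X" for x
      using that unfolding unit_interval_C_carrier s
      by (auto split: if_splits) (smt (verit))
    with 5 show ?case
      by (intro exI[of _ "\<lambda>x\<in>topspace X. b x + c x"])
        (auto simp: s add.assoc intro!: restrict_ext split: if_splits)
  next
    case 6 then show ?case by (auto simp: unit_interval_C_carrier s intro!: e)
  next
    case 7 then show ?case by (auto simp: unit_interval_C_carrier s one intro!: e)
  next
    case (8 a b)
    then have "x \<in> topspace X \<Longrightarrow> a x + b x = 1" for x
      by (auto simp: s one split: if_splits dest: fun_cong[of _ _ x])
    with 8 show ?case by (auto simp: unit_interval_C_carrier s intro!: e) (smt (verit))
  next
    case (9 a)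
    then have "a x = 0" if "x \<in> topspace X" for x
      using that unfolding unit_interval_C_carrier s one by (force split: if_splits)
    with 9 show ?case unfolding unit_interval_C_carrier s by (intro e) auto
  next
    case 10 then show ?case by (auto simp: unit_interval_C_carrier s intro!: c mult_le_one)
  next
    case 11 then show ?case by (auto simp: s fun_eq_iff)
  next
    case 12 then show ?case by (auto simp: unit_interval_C_carrier s one intro!: e)
  next
    case 13 then show ?case by (auto simp: unit_interval_C_carrier s one intro!: e)
  next
    case (14 a b c d)
    then have "a x * b x + a x * c x \<le> 1" if "x \<in> topspace X" for x
      using that mult_le_one[of "a x" "b x + c x"]
      by (auto simp: unit_interval_C_carrier s distrib_left split: if_splits)
    with 14 show ?case by (auto simp: s distrib_left split: if_splits)
  next
    case (15 a b c d)
    then have "b x * a x + c x * a x \<le> 1" if "x \<in> topspace X" for x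
      using that mult_le_one[of "b x + c x" "a x"]
      by (auto simp: unit_interval_C_carrier s distrib_right split: if_splits)
    with 15 show ?case by (auto simp: s distrib_right split: if_splits)
  qed
qed

definition cozero_set_in :: "'x topology \<Rightarrow> 'x set \<Rightarrow> bool" where
  "cozero_set_in X S \<longleftrightarrow>
     (\<exists>f. continuous_map X euclideanreal f \<and> S = {x \<in> topspace X. f x \<noteq> 0})"

definition basically_disconnected_space :: "'x topology \<Rightarrow> bool" where
  "basically_disconnected_space X \<longleftrightarrow>
     (\<forall>S. cozero_set_in X S \<longrightarrow> openin X (Abstract_Topology.closure_of X S))"


section \<open>Boolean algebras as effect monoids\<close>

definition is_complement :: "('a, 'm) gorder_scheme \<Rightarrow> 'a \<Rightarrow> 'a \<Rightarrow> bool" where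
  "is_complement L x y \<longleftrightarrow>
     y \<in> carrier L \<and> x \<sqinter>\<^bsub>L\<^esub> y = \<bottom>\<^bsub>L\<^esub> \<and> x \<squnion>\<^bsub>L\<^esub> y = \<top>\<^bsub>L\<^esub>"

locale boolean_lattice = bounded_lattice +
  assumes meet_join_distrib:
      "\<lbrakk>x \<in> carrier L; y \<in> carrier L; z \<in> carrier L\<rbrakk>
       \<Longrightarrow> x \<sqinter> (y \<squnion> z) = (x \<sqinter> y) \<squnion> (x \<sqinter> z)"
    and complement_exists: "x \<in> carrier L \<Longrightarrow> \<exists>y. is_complement L x y"

definition boolean_effect_monoid :: "('a, 'm) gorder_scheme \<Rightarrow> 'a effect_monoid" where
  "boolean_effect_monoid L =
     \<lparr>carrier = carrier L,
      ezero = \<bottom>\<^bsub>L\<^esub>,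
      eplus = (\<lambda>x y. if x \<sqinter>\<^bsub>L\<^esub> y = \<bottom>\<^bsub>L\<^esub> then Some (x \<squnion>\<^bsub>L\<^esub> y) else None),
      ecompl = (\<lambda>x. THE y. is_complement L x y),
      emult = (\<lambda>x y. x \<sqinter>\<^bsub>L\<^esub> y)\<rparr>"

context boolean_lattice
begin

lemma meet_comm: "x \<sqinter> y = y \<sqinter> x"
  by (simp add: meet_def insert_commute)

lemma meet_bottom [simp]: "x \<in> carrier L \<Longrightarrow> x \<sqinter> \<bottom> = \<bottom>" "x \<in> carrier L \<Longrightarrow> \<bottom> \<sqinter> x = \<bottom>"
  by (metis bottom_closed bottom_lower le_iff_join meet_comm)+

lemma join_bottom [simp]: "x \<in> carrier L \<Longrightarrow> x \<squnion> \<bottom> = x" "x \<in> carrier L \<Longrightarrow> \<bottom> \<squnion> x = x"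
  by (metis bottom_closed bottom_lower le_iff_meet join_comm)+

lemma meet_top [simp]: "x \<in> carrier L \<Longrightarrow> x \<sqinter> \<top> = x" "x \<in> carrier L \<Longrightarrow> \<top> \<sqinter> x = x"
  by (metis top_closed top_higher le_iff_join meet_comm)+

lemma join_top [simp]: "x \<in> carrier L \<Longrightarrow> x \<squnion> \<top> = \<top>" "x \<in> carrier L \<Longrightarrow> \<top> \<squnion> x = \<top>"
  by (metis top_closed top_higher le_iff_meet join_comm)+

lemma meet_a: "\<lbrakk>x \<in> carrier L; y \<in> carrier L; z \<in> carrier L\<rbrakk> \<Longrightarrow> (x \<sqinter> y) \<sqinter> z = x \<sqinter> (y \<sqinter> z)"
  by (metis eq_is_equal weak_meet_assoc)

lemma join_a: "\<lbrakk>x \<in> carrier L; y \<in> carrier L; z \<in> carrier L\<rbrakk> \<Longrightarrow> (x \<squnion> y) \<squnion> z = x \<squnion> (y \<squnion> z)"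
  by (metis eq_is_equal weak_join_assoc)

lemma complement_unique:
  assumes "x \<in> carrier L" "is_complement L x y" "is_complement L x z" shows "y = z"
proof -
  have *: "y = y \<sqinter> z" if "is_complement L x y" "is_complement L x z" for y z
  proof -
    have "y = y \<sqinter> (x \<squnion> z)" using that by (simp add: is_complement_def)
    also have "\<dots> = (y \<sqinter> x) \<squnion> (y \<sqinter> z)" using that assms(1)
      by (metis is_complement_def meet_join_distrib)
    also have "\<dots> = y \<sqinter> z" using that assms(1)
      by (metis is_complement_def join_bottom(2) meet_closed meet_comm)
    finally show ?thesis .
  qed
  from *[OF assms(2,3)] *[OF assms(3,2)] show ?thesis by (metis meet_comm)
qed

lemma compl_is: "x \<in> carrier L \<Longrightarrow> is_complement L x (THE y. is_complement L x y)"
  by (rule theI') (metis complement_exists complement_unique)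

lemma boolean_effect_monoid: "effect_monoid (boolean_effect_monoid L)"
proof -
  let ?B = "boolean_effect_monoid L"
  have s: "carrier ?B = carrier L" "ezero ?B = \<bottom>"
    "\<And>x y. eplus ?B x y = (if x \<sqinter> y = \<bottom> then Some (x \<squnion> y) else None)"
    "\<And>x. ecompl ?B x = (THE y. is_complement L x y)"
    "\<And>x y. emult ?B x y = x \<sqinter> y"
    by (simp_all add: boolean_effect_monoid_def)
  have "is_complement L \<bottom> \<top>" by (simp add: is_complement_def)
  then have one: "eone ?B = \<top>"
    unfolding eone_def s by (metis bottom_closed compl_is complement_unique)
  show ?thesis
  proof (unfold_locales, goal_cases)
    case 3 then show ?case using compl_is by (simp add: s is_complement_def)
  next
    case 4 then show ?case by (metis s(3) meet_comm join_comm)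
  next
    case (5 a b c d e)
    then have i: "a \<in> carrier L" "b \<in> carrier L" "c \<in> carrier L" "a \<sqinter> b = \<bottom>" "(a \<squnion> b) \<sqinter> c = \<bottom>"
      "d = a \<squnion> b" "e = (a \<squnion> b) \<squnion> c"
      by (auto simp: s split: if_splits)
    then have "(c \<sqinter> a) \<squnion> (c \<sqinter> b) = \<bottom>" using meet_join_distrib meet_comm by metis
    then have z: "c \<sqinter> a = \<bottom>" "c \<sqinter> b = \<bottom>"
      using i by (metis bottom_eq bottom_lower join_left join_right le_antisym meet_closed bottom_closed)+
    then have "a \<sqinter> (b \<squnion> c) = \<bottom>" using i by (metis meet_join_distrib meet_comm join_bottom(1) bottom_closed)
    then show ?case using z i by (auto simp: s join_a) (metis meet_comm)+
  next
    case 7 then show ?case using compl_is by (simp add: s one is_complement_def)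
  next
    case (8 a b) then have "is_complement L a b" by (auto simp: s one is_complement_def split: if_splits)
    then show ?case unfolding s using 8 by (metis compl_is complement_unique s(1))
  next
    case (14 a b c d)
    then have "(a \<sqinter> b) \<sqinter> (a \<sqinter> c) = \<bottom>"
      by (auto simp: s split: if_splits) (metis meet_a meet_comm meet_closed meet_bottom)
    then show ?case using 14 by (auto simp: s meet_join_distrib split: if_splits)
  next
    case (15 a b c d)
    then have "(b \<sqinter> a) \<sqinter> (c \<sqinter> a) = \<bottom>"
      by (auto simp: s split: if_splits) (metis meet_a meet_comm meet_closed meet_bottom)
    then show ?case using 15 by (auto simp: s split: if_splits) (metis meet_join_distrib meet_comm)
  qed (auto simp: s one meet_a split: if_splits)
qed

end

end

theory Submission
  imports Defs
begin

text \<open>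
  An effect monoid homomorphism \<open>M \<rightarrow> [0,1]\<close> is a point of a closed subset \<open>X\<close> of \<open>[0,1]\<^sup>M\<close>, and
  evaluation maps \<open>M\<close> into \<open>[0,1]\<^bsub>C(X)\<^esub>\<close>. This already embeds all of \<open>M\<close>, so the
  Boolean summand can be trivial: a Boolean algebra embeds into the functions on its Stone space.

  Everything rests on comparability: for all \<open>a\<close>, \<open>b\<close> some idempotent \<open>p\<close> satisfies \<open>a p \<le> b p\<close> and
  \<open>b (1 - p) \<le> a (1 - p)\<close>. To find it, write \<open>a = s + a'\<close> and \<open>b = s + b'\<close> with \<open>a' b' = 0\<close> and
  take the support of \<open>b'\<close>. Dividing by an ultrafilter of idempotents therefore yields a linearly
  ordered effect monoid, and such a monoid has a homomorphism to \<open>[0,1]\<close>, computed by repeated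
  doubling as a binary expansion. Hence there are enough homomorphisms to reflect the order.
  Applied to \<open>a\<close> and \<open>1 - a\<close>, comparability also shows that the idempotents give a clopen basis
  of \<open>X\<close>, and suprema of increasing sequences of idempotents give the open closures.
\<close>

section \<open>Effect algebras\<close>

context effect_algebra
begin

text \<open>With membership of the summands built in, \<open>psum a b c\<close> records definedness
  and value at once, so the laws of partial addition need no carrier hypotheses.\<close>

definition psum where
  "psum a b c \<longleftrightarrow> a \<in> carrier E \<and> b \<in> carrier E \<and> eplus E a b = Some c"

definition leq where "leq a b \<longleftrightarrow> (\<exists>c. psum a c b)"

lemma psum_closed:
  assumes "psum a b c"
  shows "a \<in> carrier E" "b \<in> carrier E" "c \<in> carrier E"
  using assms plus_closed by (auto simp: psum_def)

lemma leq_closed: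
  assumes "leq a b"
  shows "a \<in> carrier E" "b \<in> carrier E"
  using assms psum_closed by (auto simp: leq_def)

lemma psum_unique: "psum a b c \<Longrightarrow> psum a b d \<Longrightarrow> c = d"
  by (simp add: psum_def)

lemma psum_commute: "psum a b c \<Longrightarrow> psum b a c"
  by (auto simp: psum_def plus_commute)

lemma psum_assoc:
  assumes "psum a b d" "psum d c e"
  obtains f where "psum b c f" "psum a f e"
proof -
  have c: "a \<in> carrier E" "b \<in> carrier E" "c \<in> carrier E" and "eplus E a b = Some d" "eplus E d c = Some e"
    using assms by (simp_all add: psum_def)
  then obtain f where "eplus E b c = Some f" "eplus E a f = Some e"
    using plus_assoc by blast
  then show ?thesis using that c plus_closed[of b c f] by (simp add: psum_def)
qed

lemma psum_assoc':
  assumes "psum b c f" "psum a f e"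
  obtains d where "psum a b d" "psum d c e"
  using assms by (meson psum_assoc psum_commute)

text \<open>Once the total is defined, associativity delivers every inner sum of a rearrangement.
  Taking both given sums equal, it splits the double of a sum into the doubles of its terms.\<close>

lemma psum_interchange:
  assumes "psum a b c" "psum d e f" "psum c f g"
  obtains x y where "psum a d x" "psum b e y" "psum x y g"
proof -
  obtain u where u: "psum b f u" "psum a u g"
    using assms psum_assoc by blast
  obtain v where v: "psum e b v" "psum d v u"
    using assms(2) u(1) psum_assoc psum_commute by blast
  obtain x where "psum a d x" "psum x v g"
    using v(2) u(2) psum_assoc' by blast
  then show ?thesis using that v(1) psum_commute by blast
qed

lemma one_closed: "eone E \<in> carrier E"
  by (simp add: eone_def zero_closed compl_closed)

lemma psum_zero: "a \<in> carrier E \<Longrightarrow> psum a (ezero E) a"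
  by (simp add: psum_def zero_closed plus_zero)

lemma psum_zero': "a \<in> carrier E \<Longrightarrow> psum (ezero E) a a"
  by (simp add: psum_commute psum_zero)

lemma psum_compl: "a \<in> carrier E \<Longrightarrow> psum a (ecompl E a) (eone E)"
  by (simp add: psum_def compl_closed plus_compl)

lemma psum_one: "psum a b (eone E) \<Longrightarrow> b = ecompl E a"
  using compl_unique by (auto simp: psum_def)

lemma compl_compl: "a \<in> carrier E \<Longrightarrow> ecompl E (ecompl E a) = a"
  using psum_one psum_commute psum_compl by metis

lemma compl_one: "ecompl E (eone E) = ezero E"
  using psum_one psum_zero one_closed by metis

text \<open>Add the complement of \<open>d\<close> on the left: both \<open>b\<close> and
  \<open>c\<close> complete \<open>ecompl E d\<close> plus \<open>a\<close> to 1, and complements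
  are unique.\<close>

lemma psum_cancel:
  assumes "psum a b d" "psum a c d"
  shows "b = c"
proof -
  have d: "psum (ecompl E d) d (eone E)"
    using psum_closed assms(1) psum_commute psum_compl by metis
  obtain u where u: "psum (ecompl E d) a u" "psum u b (eone E)"
    using psum_assoc' assms(1) d by blast
  obtain v where v: "psum (ecompl E d) a v" "psum v c (eone E)"
    using psum_assoc' assms(2) d by blast
  show ?thesis using u v psum_unique psum_one by metis
qed

lemma psum_cancel_right: "psum b a d \<Longrightarrow> psum c a d \<Longrightarrow> b = c"
  using psum_cancel psum_commute by blast

lemma psum_eq_left: "psum a b a \<Longrightarrow> b = ezero E"
  using psum_cancel psum_zero psum_closed by blast

text \<open>Positivity: 0 + 1 is defined, so reassociating \<open>(b + a) + 1\<close> makes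
  \<open>a + 1\<close> defined, and the zero-one law applies.\<close>

lemma psum_eq_zero:
  assumes "psum a b (ezero E)"
  shows "a = ezero E"
proof -
  have "psum (ezero E) (eone E) (eone E)"
    by (simp add: one_closed psum_zero')
  then obtain f where "psum a (eone E) f"
    using assms psum_assoc psum_commute by metis
  then show ?thesis using zero_one_law by (auto simp: psum_def)
qed

section \<open>The order induced by the partial sum\<close>

lemma leq_refl: "a \<in> carrier E \<Longrightarrow> leq a a"
  using psum_zero by (auto simp: leq_def)

lemma leq_trans: "leq a b \<Longrightarrow> leq b c \<Longrightarrow> leq a c"
  unfolding leq_def using psum_assoc by metis

lemma leq_antisym:
  assumes "leq a b" "leq b a"
  shows "a = b"
proof -
  obtain c d where cd: "psum a c b" "psum b d a"
    using assms by (auto simp: leq_def)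
  then obtain f where f: "psum c d f" "psum a f a"
    using psum_assoc by blast
  then have "c = ezero E" using psum_eq_left psum_eq_zero by blast
  then show ?thesis using cd psum_unique psum_zero psum_closed by metis
qed

lemma leq_one: "a \<in> carrier E \<Longrightarrow> leq a (eone E)"
  using psum_compl by (auto simp: leq_def)

lemma leq_zero: "leq a (ezero E) \<Longrightarrow> a = ezero E"
  using psum_eq_zero by (auto simp: leq_def)

lemma psum_leq:
  assumes "psum a b c"
  shows "leq a c" "leq b c"
  using assms psum_commute by (auto simp: leq_def)

lemma psum_mono:
  assumes "psum a b c" "leq x a" "leq y b"
  obtains z where "psum x y z" "leq z c"
proof -
  obtain u v where "psum x u a" "psum y v b"
    using assms by (auto simp: leq_def)
  then obtain z w where "psum x y z" "psum z w c"
    using assms(1) psum_interchange by metis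
  then show ?thesis using that psum_leq by blast
qed

lemma psum_leq_cancel:
  assumes "psum a b c" "psum a d e" "leq c e"
  shows "leq b d"
proof -
  obtain u where "psum c u e" using assms by (auto simp: leq_def)
  then obtain f where "psum b u f" "psum a f e"
    using assms psum_assoc by blast
  then show ?thesis using assms psum_cancel psum_leq by metis
qed

lemma leq_compl:
  assumes "leq a b"
  shows "leq (ecompl E b) (ecompl E a)"
proof -
  obtain c where c: "psum a c b" using assms by (auto simp: leq_def)
  have "psum b (ecompl E b) (eone E)" using assms leq_closed psum_compl by blast
  then obtain f where "psum c (ecompl E b) f" "psum a f (eone E)"
    using c psum_assoc by blast
  then show ?thesis using psum_one psum_leq by metis
qed

lemma psum_leq_compl: "psum a b c \<Longrightarrow> leq b (ecompl E a)"
  using psum_leq_cancel[of a b c "ecompl E a" "eone E"] psum_compl leq_one psum_closed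
  by blast

text \<open>Turns an order comparison into definedness of a sum. An element below its own complement
  can therefore be doubled.\<close>

lemma leq_compl_psum:
  assumes "leq b (ecompl E a)" "a \<in> carrier E"
  obtains c where "psum a b c"
  using assms psum_mono[OF psum_compl leq_refl] by blast

lemma effect_order_leq:
  "a \<in> carrier E \<Longrightarrow> b \<in> carrier E \<Longrightarrow> a \<sqsubseteq>\<^bsub>effect_order E\<^esub> b \<longleftrightarrow> leq a b"
  by (auto simp: effect_order_def leq_def psum_def)

section \<open>Suprema of increasing sequences\<close>

definition lub_of where
  "lub_of m s \<longleftrightarrow> (\<forall>n::nat. leq (m n) s) \<and> (\<forall>u. (\<forall>n. leq (m n) u) \<longrightarrow> leq s u)"

lemma lub_of_closed:
  assumes "lub_of m s"
  shows "s \<in> carrier E" "m n \<in> carrier E"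
  using assms leq_closed unfolding lub_of_def by blast+

text \<open>Writing s = x + y and cancelling x in m n + x \<le> s shows that y is still an upper
  bound; hence s = y and x = 0. This is the form in which completeness makes leftover terms
  vanish.\<close>

lemma lub_of_absorb:
  assumes s: "lub_of m s" and x: "\<And>n. \<exists>y. psum (m n) x y \<and> leq y s"
  shows "x = ezero E"
proof -
  have "leq x s" using x[of 0] psum_leq leq_trans by blast
  then obtain y where y: "psum x y s" by (auto simp: leq_def)
  have "leq (m n) y" for n
  proof -
    obtain z where z: "psum (m n) x z" "leq z s" using x by blast
    show ?thesis using psum_leq_cancel[OF psum_commute[OF z(1)] y] z(2) by simp
  qed
  then have "leq s y" using s by (simp add: lub_of_def)
  then have "s = y" using y psum_leq leq_antisym by blast
  then show ?thesis using y psum_commute psum_eq_left by blast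
qed

lemma omega_complete_lub:
  assumes "omega_complete E" and inc: "\<And>n. leq (m n) (m (Suc n))"
  obtains s where "lub_of m s"
proof -
  have c: "m n \<in> carrier E" for n using inc leq_closed by blast
  then have "\<forall>n. m n \<sqsubseteq>\<^bsub>effect_order E\<^esub> m (Suc n)"
    using inc effect_order_leq by blast
  then obtain s where s: "is_lub (effect_order E) s (range m)"
    using assms(1) c unfolding omega_complete_def by blast
  have sc: "s \<in> carrier E"
    using s by (auto simp: least_def Upper_def effect_order_def)
  have ub: "leq (m n) s" for n
    using s sc c effect_order_leq by (auto simp: least_def Upper_def effect_order_def)
  have "leq s u" if "\<And>n. leq (m n) u" for u
  proof -
    have u: "u \<in> carrier E" using that leq_closed by blast
    then have "u \<in> Upper (effect_order E) (range m)"
      using that c effect_order_leq by (auto simp: Upper_def effect_order_def leq_def psum_def)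
    then show ?thesis using s sc u effect_order_leq by (auto simp: least_def)
  qed
  then show ?thesis using that[of s] ub unfolding lub_of_def by blast
qed

end

text \<open>There are no infinitesimals: if every double exists, adding \<open>d 0\<close> to
  \<open>d n\<close> stays below \<open>d (Suc n)\<close> and hence below the supremum, so
  \<open>d 0\<close> is absorbed.\<close>

lemma (in effect_algebra) psum_self_all_imp_zero:
  assumes "omega_complete E" and d: "\<And>n::nat. psum (d n) (d n) (d (Suc n))"
  shows "d 0 = ezero E"
proof -
  obtain s where s: "lub_of d s"
    using omega_complete_lub[of d] assms psum_leq by blast
  have ub: "leq (d n) s" for n using s by (simp add: lub_of_def)
  have le: "leq (d 0) (d n)" for n
  proof (induction n)
    case 0 then show ?case using d psum_closed leq_refl by blast
  next
    case (Suc n) then show ?case using d psum_leq leq_trans by blast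
  qed
  have "\<exists>y. psum (d n) (d 0) y \<and> leq y s" for n
    using psum_mono[OF d leq_refl le] d ub leq_trans psum_closed by metis
  then show ?thesis using s lub_of_absorb by blast
qed

section \<open>Idempotents and comparability\<close>

context effect_monoid
begin

abbreviation mul (infixl "\<odot>" 70) where "a \<odot> b \<equiv> emult M a b"

abbreviation neg where "neg a \<equiv> ecompl M a"

abbreviation nul where "nul \<equiv> ezero M"

abbreviation unt where "unt \<equiv> eone M"

lemma mult_psum: "psum b c d \<Longrightarrow> a \<in> carrier M \<Longrightarrow> psum (a \<odot> b) (a \<odot> c) (a \<odot> d)"
  by (simp add: psum_def mult_closed distrib_left)

lemma psum_mult: "psum b c d \<Longrightarrow> a \<in> carrier M \<Longrightarrow> psum (b \<odot> a) (c \<odot> a) (d \<odot> a)"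
  by (simp add: psum_def mult_closed distrib_right)

lemma mult_zero: "a \<in> carrier M \<Longrightarrow> a \<odot> nul = nul"
  using psum_eq_left mult_psum psum_zero zero_closed by metis

lemma zero_mult: "a \<in> carrier M \<Longrightarrow> nul \<odot> a = nul"
  using psum_eq_left psum_mult psum_zero zero_closed by metis

lemma mult_left_mono: "leq b c \<Longrightarrow> a \<in> carrier M \<Longrightarrow> leq (a \<odot> b) (a \<odot> c)"
  unfolding leq_def using mult_psum by blast

lemma mult_right_mono: "leq b c \<Longrightarrow> a \<in> carrier M \<Longrightarrow> leq (b \<odot> a) (c \<odot> a)"
  unfolding leq_def using psum_mult by blast

lemma mult_mono: "leq a b \<Longrightarrow> leq c d \<Longrightarrow> leq (a \<odot> c) (b \<odot> d)"
  by (meson leq_closed leq_trans mult_left_mono mult_right_mono)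

lemma mult_leq_left: "a \<in> carrier M \<Longrightarrow> b \<in> carrier M \<Longrightarrow> leq (a \<odot> b) a"
  using mult_left_mono[OF leq_one] mult_one_right by metis

lemma mult_leq_right: "a \<in> carrier M \<Longrightarrow> b \<in> carrier M \<Longrightarrow> leq (a \<odot> b) b"
  using mult_right_mono[OF leq_one] mult_one_left by metis

lemma split_right:
  "a \<in> carrier M \<Longrightarrow> b \<in> carrier M \<Longrightarrow> psum (a \<odot> b) (a \<odot> neg b) a"
  using mult_psum[OF psum_compl] mult_one_right by metis

lemma split_left:
  "a \<in> carrier M \<Longrightarrow> b \<in> carrier M \<Longrightarrow> psum (b \<odot> a) (neg b \<odot> a) a"
  using psum_mult[OF psum_compl] mult_one_left by metis

section \<open>Idempotents and their centrality\<close>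

definition idem where "idem p \<longleftrightarrow> p \<in> carrier M \<and> p \<odot> p = p"

lemma idem_closed: "idem p \<Longrightarrow> p \<in> carrier M"
  by (simp add: idem_def)

lemma idem_mult_neg: "idem p \<Longrightarrow> p \<odot> neg p = nul"
  using split_right[of p p] psum_eq_left by (auto simp: idem_def)

lemma idem_neg_mult: "idem p \<Longrightarrow> neg p \<odot> p = nul"
  using split_left[of p p] psum_eq_left by (auto simp: idem_def)

lemma idem_neg: "idem p \<Longrightarrow> idem (neg p)"
  using split_right[of "neg p" p] idem_neg_mult[of p] psum_zero'[of "neg p \<odot> neg p"]
    psum_unique mult_closed compl_closed
  by (simp add: idem_def)

lemma idem_one: "idem unt"
  by (simp add: idem_def one_closed mult_one_left)

lemma idem_zero: "idem nul"
  by (simp add: idem_def zero_closed mult_zero)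

text \<open>The corners p a (1 - p) and (1 - p) a p lie below p (1 - p) and (1 - p) p, which are 0.
  Hence p a and a p both equal p a p.\<close>

lemma idem_central:
  assumes p: "idem p" and a: "a \<in> carrier M"
  shows "p \<odot> a = a \<odot> p"
proof -
  have c: "p \<in> carrier M" "neg p \<in> carrier M" using p idem_closed compl_closed by auto
  have "leq (p \<odot> a \<odot> neg p) (p \<odot> neg p)"
    using c a mult_leq_left mult_right_mono by blast
  then have l: "p \<odot> a \<odot> neg p = nul" using idem_mult_neg[OF p] leq_zero by simp
  have "leq (neg p \<odot> (a \<odot> p)) (neg p \<odot> p)"
    using c a mult_leq_right mult_left_mono by blast
  then have r: "neg p \<odot> (a \<odot> p) = nul" using idem_neg_mult[OF p] leq_zero by simp
  have "psum (p \<odot> a \<odot> p) nul (p \<odot> a)"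
    using split_right[of "p \<odot> a" p] l c a mult_closed by simp
  moreover have "psum (p \<odot> a \<odot> p) nul (a \<odot> p)"
    using split_left[of "a \<odot> p" p] r c a mult_closed mult_assoc by simp
  ultimately show ?thesis using psum_unique by blast
qed

lemma idem_mult:
  assumes "idem p" "idem q"
  shows "idem (p \<odot> q)"
proof -
  have c: "p \<in> carrier M" "q \<in> carrier M" using assms idem_closed by auto
  have "p \<odot> q \<odot> (p \<odot> q) = p \<odot> (q \<odot> p) \<odot> q" using c mult_assoc mult_closed by simp
  also have "\<dots> = p \<odot> (p \<odot> q) \<odot> q" using idem_central assms c by simp
  also have "\<dots> = p \<odot> p \<odot> (q \<odot> q)" using c mult_assoc mult_closed by simp
  finally show ?thesis using assms c mult_closed by (simp add: idem_def)
qed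

text \<open>Both elements are the sums of their parts on p and on 1 - p, so the order can be tested
  on each part.\<close>

lemma leq_idemI:
  assumes "idem p" "leq (a \<odot> p) (b \<odot> p)" "leq (a \<odot> neg p) (b \<odot> neg p)"
    and c: "a \<in> carrier M" "b \<in> carrier M"
  shows "leq a b"
proof -
  have "psum (b \<odot> p) (b \<odot> neg p) b" using split_right assms idem_closed by blast
  then obtain z where "psum (a \<odot> p) (a \<odot> neg p) z" "leq z b"
    using psum_mono assms by metis
  then show ?thesis using split_right assms(1) c(1) idem_closed psum_unique by metis
qed

end

section \<open>Normal multiplication, supports and comparability\<close>

locale omega_effect_monoid = effect_monoid +
  assumes omega_complete: "omega_complete M"
begin

lemma lub_exists:
  assumes "\<And>n. leq (m n) (m (Suc n))"
  obtains s where "lub_of m s"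
  using omega_complete_lub[OF omega_complete, of m] assms by blast

text \<open>With \<open>s = m n + c n\<close>, the defect \<open>x\<close> of \<open>F s\<close> satisfies \<open>x \<le> F (c n) \<le> c n\<close>
  for every \<open>n\<close>, so it vanishes.\<close>

lemma lub_of_contraction:
  assumes s: "lub_of m s" and inc: "\<And>n. leq (m n) (m (Suc n))"
    and add: "\<And>a b c. psum a b c \<Longrightarrow> psum (F a) (F b) (F c)"
    and le: "\<And>a. a \<in> carrier M \<Longrightarrow> leq (F a) a"
  shows "lub_of (\<lambda>n. F (m n)) (F s)"
proof -
  have mono: "leq (F a) (F b)" if "leq a b" for a b
    using that add unfolding leq_def by blast
  obtain u where u: "lub_of (\<lambda>n. F (m n)) u"
    using lub_exists[of "\<lambda>n. F (m n)"] mono inc by blast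
  have "leq u (F s)" using u s mono by (simp add: lub_of_def)
  then obtain x where x: "psum u x (F s)" by (auto simp: leq_def)
  have "\<exists>y. psum (m n) x y \<and> leq y s" for n
  proof -
    obtain c where c: "psum (m n) c s" using s by (auto simp: lub_of_def leq_def)
    obtain y where y: "psum (F (m n)) y u" using u by (auto simp: lub_of_def leq_def)
    obtain f where f: "psum y x f" "psum (F (m n)) f (F s)"
      using psum_assoc[OF y x] by blast
    have "f = F c" using f(2) add[OF c] psum_cancel by blast
    then have "leq x c" using psum_leq(2)[OF f(1)] le[OF psum_closed(2)[OF c]] leq_trans by blast
    then show ?thesis using psum_mono[OF c leq_refl[OF psum_closed(1)[OF c]]] by blast
  qed
  then have "x = nul" using lub_of_absorb[OF s] by blast
  then have "u = F s" using x psum_unique psum_zero psum_closed by metis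
  then show ?thesis using u by simp
qed

lemma lub_of_mult:
  assumes "lub_of m s" "\<And>n. leq (m n) (m (Suc n))" "a \<in> carrier M"
  shows "lub_of (\<lambda>n. a \<odot> m n) (a \<odot> s)"
  by (rule lub_of_contraction[OF assms(1,2)]) (use assms(3) mult_psum mult_leq_right in auto)

lemma lub_of_mult':
  assumes "lub_of m s" "\<And>n. leq (m n) (m (Suc n))" "a \<in> carrier M"
  shows "lub_of (\<lambda>n. m n \<odot> a) (s \<odot> a)"
  by (rule lub_of_contraction[OF assms(1,2)]) (use assms(3) psum_mult mult_leq_left in auto)

lemma lub_of_unique: "lub_of m s \<Longrightarrow> lub_of m t \<Longrightarrow> s = t"
  by (auto simp: lub_of_def intro: leq_antisym)

lemma lub_of_const: "a \<in> carrier M \<Longrightarrow> lub_of (\<lambda>n. a) a"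
  by (simp add: lub_of_def leq_refl)

text \<open>The idempotent is the supremum of \<open>1 - (1 - b)\<^sup>n\<close>.\<close>

lemma support_exists:
  assumes a: "a \<in> carrier M" and b: "b \<in> carrier M" and ab: "a \<odot> b = nul"
  obtains p where "idem p" "b \<odot> p = b" "a \<odot> p = nul"
proof -
  define h where "h n = ((\<odot>) (neg b) ^^ n) unt" for n :: nat
  define k where "k n = neg (h n)" for n
  have hS: "h (Suc n) = neg b \<odot> h n" for n by (simp add: h_def)
  have hc: "h n \<in> carrier M" for n
    by (induction n) (auto simp: hS mult_closed compl_closed b, simp add: h_def one_closed)
  have kc: "k n \<in> carrier M" for n by (simp add: k_def hc compl_closed)
  \<comment> \<open>The recursion k (n + 1) = b + (1 - b) k n, from which all later facts about
    \<open>k\<close> follow by induction.\<close>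
  have kS: "psum b (neg b \<odot> k n) (k (Suc n))" for n
  proof -
    have "psum (neg b \<odot> k n) (neg b \<odot> h n) (neg b)"
      using mult_psum[OF psum_compl[OF hc]] b compl_closed mult_one_right psum_commute
      by (simp add: k_def)
    then obtain d where d: "psum b (neg b \<odot> k n) d" "psum d (h (Suc n)) unt"
      using psum_compl[OF b] psum_assoc' unfolding hS by blast
    then have "d = k (Suc n)" unfolding k_def using psum_one psum_commute by blast
    then show ?thesis using d(1) by simp
  qed
  have inc: "leq (k n) (k (Suc n))" for n
    unfolding k_def hS by (intro leq_compl mult_leq_right hc compl_closed b)
  obtain r where r: "lub_of k r" using lub_exists[of k, OF inc] by blast
  have rc: "r \<in> carrier M" using r lub_of_closed by blast
  \<comment> \<open>In the limit the recursion becomes r = b + (1 - b) r. Comparison with r = b r +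
    (1 - b) r then gives b r = b.\<close>
  have br: "psum b (neg b \<odot> r) r"
  proof -
    have bl: "lub_of (\<lambda>n. neg b \<odot> k n) (neg b \<odot> r)"
      using lub_of_mult[OF r inc] b compl_closed by blast
    have "leq b r" using kS[of 0] r psum_leq leq_trans unfolding lub_of_def by blast
    then obtain c where c: "psum b c r" by (auto simp: leq_def)
    have "leq (neg b \<odot> k n) c" for n
      using psum_leq_cancel[OF kS c] r by (simp add: lub_of_def)
    then have l: "leq (neg b \<odot> r) c" using bl by (simp add: lub_of_def)
    obtain z where z: "psum b (neg b \<odot> r) z" "leq z r"
      using psum_mono[OF c leq_refl[OF b] l] by blast
    have "leq (k n) z" for n
    proof -
      have kz: "leq (k (Suc n)) z"
        using psum_mono[OF z(1) leq_refl[OF b], of "neg b \<odot> k n"] bl kS psum_unique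
        unfolding lub_of_def by metis
      then show ?thesis using inc leq_trans by blast
    qed
    then have "leq r z" using r by (simp add: lub_of_def)
    then show ?thesis using z leq_antisym by metis
  qed
  have b_r: "b \<odot> r = b"
    using br split_left[OF rc b] psum_cancel_right by blast
  \<comment> \<open>By the recursion and b r = b, multiplication by \<open>r\<close> fixes every
    \<open>k n\<close>; taking suprema gives r r = r.\<close>
  have kr: "k n \<odot> r = k n" for n
  proof (induction n)
    case 0
    have "k 0 = nul" by (simp add: k_def h_def compl_one)
    then show ?case using rc zero_mult by simp
  next
    case (Suc n)
    have "psum b (neg b \<odot> k n) (k (Suc n) \<odot> r)"
      using psum_mult[OF kS[of n] rc] b_r Suc mult_assoc kc rc b compl_closed by simp
    then show ?case using kS psum_unique by blast
  qed
  have "r \<odot> r = r"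
    using lub_of_mult'[OF r inc rc] r lub_of_unique by (simp add: kr)
  then have "idem r" using rc by (simp add: idem_def)
  moreover have "a \<odot> r = nul"
  proof -
    \<comment> \<open>Since a b = 0, multiplying \<open>a\<close> by 1 - b changes nothing, so
      \<open>a\<close> annihilates every \<open>k n\<close> and thus their supremum.\<close>
    have nb: "a \<odot> neg b = a"
      using split_right[OF a b] ab psum_zero' psum_unique psum_closed by metis
    have "a \<odot> k n = nul" for n
    proof (induction n)
      case 0 then show ?case using a mult_zero by (simp add: k_def h_def compl_one)
    next
      case (Suc n)
      have "a \<odot> (neg b \<odot> k n) = nul"
        using Suc nb mult_assoc[OF a compl_closed[OF b] kc] by simp
      then show ?case
        using mult_psum[OF kS[of n] a] ab psum_zero[OF zero_closed] psum_unique by metis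
    qed
    then show ?thesis
      using lub_of_mult[OF r inc a] lub_of_unique lub_of_const[OF zero_closed] by simp
  qed
  ultimately show ?thesis using that b_r by blast
qed

text \<open>The pair \<open>(x, y) = (a, b)\<close> is repeatedly replaced by \<open>(x (1 - y), (1 - x) y)\<close>; each step
  removes \<open>x y\<close> from both members, and \<open>s\<close> is everything that is ever removed.\<close>

lemma meet_decomposition:
  assumes "a \<in> carrier M" "b \<in> carrier M"
  obtains s a' b' where "psum s a' a" "psum s b' b" "a' \<odot> b' = nul"
proof -
  let ?P = "\<lambda>(n::nat) (m, x, y). psum m x a \<and> psum m y b"
  let ?Q = "\<lambda>(n::nat) (m, x, y) (m', x', y'). psum m (x \<odot> y) m'"
  have "\<exists>f. \<forall>n. ?P n (f n) \<and> ?Q n (f n) (f (Suc n))"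
  proof (rule dependent_nat_choice)
    show "\<exists>z. ?P 0 z" using assms psum_zero' by auto
    fix z n assume "?P n z"
    then obtain m x y where z: "z = (m, x, y)" and m: "psum m x a" "psum m y b" by auto
    have c: "x \<in> carrier M" "y \<in> carrier M" using m psum_closed by auto
    \<comment> \<open>Here x = x y + x (1 - y) and y = x y + (1 - x) y, so the same product passes
      from both remainders into the common part.\<close>
    obtain m' where m': "psum m (x \<odot> y) m'" "psum m' (x \<odot> neg y) a"
      using psum_assoc'[OF split_right[OF c] m(1)] by blast
    obtain m'' where "psum m (x \<odot> y) m''" "psum m'' (neg x \<odot> y) b"
      using psum_assoc'[OF split_left[OF c(2,1)] m(2)] by blast
    then have "psum m' (neg x \<odot> y) b" using m' psum_unique by blast
    then show "\<exists>z'. ?P (Suc n) z' \<and> ?Q n z z'"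
      using m' z by (intro exI[of _ "(m', x \<odot> neg y, neg x \<odot> y)"]) simp
  qed
  then obtain f where "\<forall>n. ?P n (f n) \<and> ?Q n (f n) (f (Suc n))" by (elim exE)
  then have f: "?P n (f n)" "?Q n (f n) (f (Suc n))" for n by (drule_tac spec[of _ n], simp)+
  define m where "m n = fst (f n)" for n
  define x where "x n = fst (snd (f n))" for n
  define y where "y n = snd (snd (f n))" for n
  have m: "psum (m n) (x n) a" "psum (m n) (y n) b" "psum (m n) (x n \<odot> y n) (m (Suc n))" for n
    using f[of n] by (auto simp: m_def x_def y_def split: prod.splits)
  have inc: "leq (m n) (m (Suc n))" for n using m(3) psum_leq by blast
  obtain s where s: "lub_of m s" using lub_exists[of m, OF inc] by blast
  have ub: "leq (m n) s" for n using s by (simp add: lub_of_def)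
  have "leq s a" "leq s b" using s m(1,2) psum_leq unfolding lub_of_def by blast+
  then obtain a' b' where ab: "psum s a' a" "psum s b' b" by (auto simp: leq_def)
  \<comment> \<open>As \<open>m n\<close> is below \<open>s\<close>, what remains after removing
    \<open>s\<close> is below what remains after removing \<open>m n\<close>. Hence a' b' \<le> x n
    y n, so adding a' b' to \<open>m n\<close> stays below \<open>m (Suc n)\<close>, and absorption
    applies.\<close>
  have rem: "leq d' d" if de: "psum s d' e" "psum (m n) d e" for d d' e n
  proof -
    obtain k where k: "psum (m n) k s" using ub by (auto simp: leq_def)
    obtain g where "psum k d' g" "psum (m n) g e" using psum_assoc[OF k de(1)] by blast
    then show ?thesis using de(2) psum_cancel psum_leq by metis
  qed
  have "\<exists>z. psum (m n) (a' \<odot> b') z \<and> leq z s" for n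
  proof -
    have "leq (a' \<odot> b') (x n \<odot> y n)"
      using rem[OF ab(1) m(1)] rem[OF ab(2) m(2)] mult_mono by blast
    then show ?thesis
      using psum_mono[OF m(3) leq_refl, of n "a' \<odot> b'"] m(1) psum_closed ub leq_trans by metis
  qed
  then have "a' \<odot> b' = nul" using lub_of_absorb[OF s] by blast
  then show ?thesis using that ab by blast
qed

text \<open>On p the remainder a' is gone, so \<open>a\<close> coincides there with the common part
  s, which is below \<open>b\<close>; off p the remainder b' is gone and the roles are
  exchanged.\<close>

lemma comparability:
  assumes a: "a \<in> carrier M" and b: "b \<in> carrier M"
  obtains p where "idem p" "leq (a \<odot> p) (b \<odot> p)" "leq (b \<odot> neg p) (a \<odot> neg p)"
proof -
  obtain s a' b' where s: "psum s a' a" "psum s b' b" "a' \<odot> b' = nul"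
    using meet_decomposition[OF a b] by blast
  have c: "s \<in> carrier M" "a' \<in> carrier M" "b' \<in> carrier M" using s psum_closed by auto
  obtain p where p: "idem p" "b' \<odot> p = b'" "a' \<odot> p = nul"
    using support_exists[OF c(2,3) s(3)] by blast
  have pc: "p \<in> carrier M" "neg p \<in> carrier M" using p idem_closed compl_closed by auto
  have "a \<odot> p = s \<odot> p"
    using psum_mult[OF s(1) pc(1)] p(3) psum_zero psum_unique psum_closed by metis
  then have 1: "leq (a \<odot> p) (b \<odot> p)" using psum_leq psum_mult[OF s(2) pc(1)] by metis
  have "b' \<odot> neg p = nul"
    using split_right[OF c(3) pc(1)] p(2) psum_eq_left by simp
  then have "b \<odot> neg p = s \<odot> neg p"
    using psum_mult[OF s(2) pc(2)] psum_zero psum_unique psum_closed by metis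
  then have "leq (b \<odot> neg p) (a \<odot> neg p)" using psum_leq psum_mult[OF s(1) pc(2)] by metis
  then show ?thesis using that p(1) 1 by blast
qed

end

section \<open>Linearly ordered effect monoids\<close>

text \<open>A digit test \<open>P\<close> and a shift \<open>T\<close> determine a number by binary
  expansion. Iterating the equation from 0 converges, because n steps of it shrink any discrepancy
  between values in [0,1] to at most \<open>(1/2) ^ n\<close>.\<close>

lemma halving_function_exists:
  obtains \<phi> :: "'a \<Rightarrow> real"
  where "\<And>a. \<phi> a = (if P a then \<phi> (T a) / 2 else 1 - \<phi> (T a) / 2)" "\<And>a. 0 \<le> \<phi> a" "\<And>a. \<phi> a \<le> 1"
proof -
  define f :: "nat \<Rightarrow> 'a \<Rightarrow> real" where
    "f = rec_nat (\<lambda>a. 0) (\<lambda>n g a. if P a then g (T a) / 2 else 1 - g (T a) / 2)"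
  have f0: "f 0 a = 0" for a by (simp add: f_def)
  have fS: "f (Suc n) a = (if P a then f n (T a) / 2 else 1 - f n (T a) / 2)" for n a
    by (simp add: f_def)
  have b: "0 \<le> f n a \<and> f n a \<le> 1" for n a
  proof (induction n arbitrary: a)
    case (Suc n)
    have "0 \<le> f n (T a) \<and> f n (T a) \<le> 1" by (rule Suc)
    then show ?case by (auto simp: fS)
  qed (simp add: f0)
  have close: "\<bar>f (n + k) a - f n a\<bar> \<le> (1/2) ^ n" for n k a
  proof (induction n arbitrary: a)
    case 0 then show ?case using b[of k a] by (simp add: f0)
  next
    case (Suc n)
    have "\<bar>f (Suc n + k) a - f (Suc n) a\<bar> = \<bar>f (n + k) (T a) - f n (T a)\<bar> / 2"
      by (cases "P a") (simp_all add: fS abs_minus_commute flip: diff_divide_distrib)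
    then show ?case using Suc[of "T a"] by simp
  qed
  have "convergent (\<lambda>n. f n a)" for a
  proof (intro real_Cauchy_convergent metric_CauchyI)
    fix e :: real assume e: "e > 0"
    obtain N where N: "(1/2::real) ^ N < e / 2"
      using real_arch_pow_inv[of "e / 2" "1/2"] e by auto
    have "dist (f m a) (f n a) < e" if "m \<ge> N" "n \<ge> N" for m n
    proof -
      obtain i j where "m = N + i" "n = N + j" using \<open>m \<ge> N\<close> \<open>n \<ge> N\<close> le_Suc_ex by blast
      then show ?thesis using close[of N i a] close[of N j a] N by (simp add: dist_real_def)
    qed
    then show "\<exists>M. \<forall>m\<ge>M. \<forall>n\<ge>M. dist (f m a) (f n a) < e" by blast
  qed
  then obtain \<phi> where lim: "(\<lambda>n. f n a) \<longlonglongrightarrow> \<phi> a" for a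
    unfolding convergent_def by metis
  show ?thesis
  proof
    fix a
    have "(\<lambda>n. f (Suc n) a) \<longlonglongrightarrow> (if P a then \<phi> (T a) / 2 else 1 - \<phi> (T a) / 2)"
      using lim[of "T a"] by (auto simp: fS intro!: tendsto_intros)
    then show "\<phi> a = (if P a then \<phi> (T a) / 2 else 1 - \<phi> (T a) / 2)"
      using LIMSEQ_unique[OF LIMSEQ_Suc[OF lim[of a]]] by metis
    show "0 \<le> \<phi> a" using b by (intro LIMSEQ_le_const[OF lim]) auto
    show "\<phi> a \<le> 1" using b by (intro LIMSEQ_le_const2[OF lim]) auto
  qed
qed

lemma abs_half:
  fixes s t :: real
  assumes "s = t / 2 \<or> s = - t / 2"
  shows "\<bar>s\<bar> = \<bar>t\<bar> / 2"
  using assms by auto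

lemma zero_if_le_half_powers:
  fixes x :: real
  assumes "\<And>n. \<bar>x\<bar> \<le> c * (1/2) ^ n"
  shows "x = 0"
proof -
  have "(\<lambda>n. c * (1/2) ^ n) \<longlonglongrightarrow> c * 0"
    by (intro tendsto_intros LIMSEQ_power_zero) simp
  then have "\<bar>x\<bar> \<le> c * 0" using assms by (intro LIMSEQ_le_const) auto
  then show ?thesis by simp
qed

text \<open>Fixing the value 0 outside the carrier makes a homomorphism a definite point of the cube
  over the whole type, which gives a compact space of them.\<close>

definition (in effect_monoid) unit_hom :: "('a \<Rightarrow> real) \<Rightarrow> bool" where
  "unit_hom \<phi> \<longleftrightarrow> \<phi> unt = 1 \<and> (\<forall>a. 0 \<le> \<phi> a) \<and> (\<forall>a. a \<notin> carrier M \<longrightarrow> \<phi> a = 0) \<and>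
     (\<forall>a b c. psum a b c \<longrightarrow> \<phi> c = \<phi> a + \<phi> b) \<and>
     (\<forall>a\<in>carrier M. \<forall>b\<in>carrier M. \<phi> (a \<odot> b) = \<phi> a * \<phi> b)"

section \<open>Binary expansions in the linearly ordered case\<close>

locale linear_effect_monoid = effect_monoid +
  assumes linear: "a \<in> carrier M \<Longrightarrow> b \<in> carrier M \<Longrightarrow> leq a b \<or> leq b a"
    and nontrivial: "ezero M \<noteq> eone M"
begin

text \<open>The digit test: that the double exists means that the element is at most one
  half.\<close>

definition small where "small a \<longleftrightarrow> (\<exists>c. psum a a c)"

lemma small_or_small_neg:
  assumes "a \<in> carrier M"
  shows "small a \<or> small (neg a)"
  using linear[of a "neg a"] assms compl_closed compl_compl leq_compl_psum[of a a]
    leq_compl_psum[of "neg a" "neg a"]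
  unfolding small_def by metis

lemma small_neg_neg: "a \<in> carrier M \<Longrightarrow> \<not> small a \<Longrightarrow> small (neg a)"
  using small_or_small_neg by blast

text \<open>Formally 1 - z = z + (1 - 2z): both sides complete z to 1, so cancellation identifies
  them.\<close>

lemma small_complement:
  assumes "psum z c unt" "psum z z z2"
  shows "psum z (neg z2) c"
proof -
  obtain f where f: "psum z (neg z2) f" "psum z f unt"
    using psum_assoc[OF assms(2)] psum_compl psum_closed assms(2) by metis
  then have "f = c" using assms(1) psum_cancel by blast
  then show ?thesis using f by simp
qed

text \<open>Formally \<open>(1 - 2b) + (1 - 2z) = 2a\<close> whenever \<open>a + b + z = 1\<close>.\<close>

lemma complementary_doubles_ordered:
  assumes s: "psum a b c" "psum c z unt" and d: "psum a a a2" "psum b b b2" "psum z z z2"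
    and bz: "leq b z"
  shows "psum (neg b2) (neg z2) a2"
proof -
  \<comment> \<open>With z = b + k one gets k + (1 - 2z) = a and a + k = 1 - 2b; adding
    \<open>a\<close> to the first of these gives the claim.\<close>
  obtain k where k: "psum b k z" using bz by (auto simp: leq_def)
  have zv: "psum z (neg z2) c" using small_complement[OF psum_commute[OF s(2)] d(3)] .
  obtain w where w: "psum a z w" "psum b w unt"
    using psum_assoc[OF psum_commute[OF s(1)] s(2)] by blast
  have bu: "psum b (neg b2) w" using small_complement[OF w(2) d(2)] .
  obtain f where f: "psum k (neg z2) f" "psum b f c" using psum_assoc[OF k zv] by blast
  have kv: "psum k (neg z2) a" using f psum_commute[OF s(1)] psum_cancel by metis
  obtain g where g: "psum k a g" "psum b g w" using psum_assoc[OF k psum_commute[OF w(1)]] by blast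
  have ak: "psum a k (neg b2)" using g bu psum_cancel psum_commute by metis
  obtain h where h: "psum a k h" "psum h (neg z2) a2" using psum_assoc'[OF kv d(1)] by blast
  then show ?thesis using ak psum_unique by blast
qed

text \<open>The claim is symmetric in b and z, and linearity puts one of them below the
  other.\<close>

lemma complementary_doubles:
  assumes s: "psum a b c" "psum c z unt" and d: "psum a a a2" "psum b b b2" "psum z z z2"
  shows "psum (neg b2) (neg z2) a2"
proof -
  consider "leq b z" | "leq z b" using linear psum_closed s by blast
  then show ?thesis
  proof cases
    case 1 then show ?thesis using complementary_doubles_ordered assms by blast
  next
    case 2
    obtain w where w: "psum a z w" "psum b w unt"
      using psum_assoc[OF psum_commute[OF s(1)] s(2)] by blast
    then show ?thesis
      using complementary_doubles_ordered[OF w(1) psum_commute[OF w(2)] d(1,3,2) 2]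
        psum_commute by blast
  qed
qed

text \<open>\<psi> reads an element as a binary expansion, passing to the complement whenever the
  double does not exist. The defects of additivity and multiplicativity are bounded, and one
  doubling step replaces each by half the defect of another instance, so both are 0.\<close>

lemma unit_hom_exists: "\<exists>\<phi>. unit_hom \<phi>"
proof -
  define dbl where "dbl a = (SOME c. psum a a c)" for a
  have dbl: "dbl a = c" if "psum a a c" for a c
    using that psum_unique unfolding dbl_def by blast
  define T where "T a = (if small a then dbl a else dbl (neg a))" for a
  obtain \<psi> :: "'a \<Rightarrow> real" where
    \<psi>: "\<And>a. \<psi> a = (if small a then \<psi> (T a) / 2 else 1 - \<psi> (T a) / 2)"
    and bd: "\<And>a. 0 \<le> \<psi> a" "\<And>a. \<psi> a \<le> 1"
    using halving_function_exists[of small T] by blast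
  have F1: "\<psi> a = \<psi> c / 2" if "psum a a c" for a c
    using \<psi>[of a] that dbl[OF that] by (auto simp: small_def T_def)
  have F2: "\<psi> a = 1 - \<psi> c / 2" if "\<not> small a" "psum (neg a) (neg a) c" for a c
    using \<psi>[of a] that dbl[OF that(2)] by (auto simp: T_def)
  have \<psi>0: "\<psi> nul = 0" using F1[OF psum_zero[OF zero_closed]] by simp
  have \<psi>1: "\<psi> unt = 1"
  proof -
    have "\<not> small unt"
      using zero_one_law[OF one_closed] nontrivial unfolding small_def psum_def by fastforce
    moreover have "psum (neg unt) (neg unt) nul"
      using psum_zero[OF zero_closed] by (simp add: compl_one)
    ultimately have "\<psi> unt = 1 - \<psi> nul / 2" by (rule F2)
    then show ?thesis by (simp add: \<psi>0)
  qed
  have neg1: "\<psi> (neg a) = 1 - \<psi> a" if a: "a \<in> carrier M" "small a" for a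
  proof -
    obtain c where c: "psum a a c" using a(2) by (auto simp: small_def)
    show ?thesis
    proof (cases "small (neg a)")
      case True
      then obtain d where d: "psum (neg a) (neg a) d" by (auto simp: small_def)
      \<comment> \<open>If an element and its complement can both be doubled, they are equal, and
        the value is 1/2.\<close>
      have "leq a (neg a)" using psum_leq_compl[OF c] .
      moreover have "leq (neg a) a" using psum_leq_compl[OF d] compl_compl a by simp
      ultimately have e: "neg a = a" using leq_antisym by blast
      then have "psum a a unt" using psum_compl[OF a(1)] by simp
      then show ?thesis using F1[of a unt] \<psi>1 e by simp
    next
      case False
      then show ?thesis using F2[OF False, of c] F1[OF c] c compl_compl[OF a(1)] by simp
    qed
  qed
  have neg: "\<psi> (neg a) = 1 - \<psi> a" if a: "a \<in> carrier M" for a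
    using neg1[of a] neg1[of "neg a"] small_or_small_neg[OF a] compl_compl[OF a]
      compl_closed[OF a] a by auto
  \<comment> \<open>The factor 2 covers the start of the induction, where all that is known is that
    three values lie in [0,1].\<close>
  have add_bound: "\<bar>\<psi> a + \<psi> b - \<psi> c\<bar> \<le> 2 * (1/2) ^ n" if "psum a b c" for a b c n
    using that
  proof (induction n arbitrary: a b c)
    case 0
    then show ?case using bd[of a] bd[of b] bd[of c] by auto
  next
    case (Suc n)
    note s = Suc.prems
    have halve: ?case if "psum x y w" "\<psi> a + \<psi> b - \<psi> c = (\<psi> x + \<psi> y - \<psi> w) / 2 \<or>
        \<psi> a + \<psi> b - \<psi> c = - (\<psi> x + \<psi> y - \<psi> w) / 2" for x y w
    proof -
      have "\<bar>\<psi> a + \<psi> b - \<psi> c\<bar> = \<bar>\<psi> x + \<psi> y - \<psi> w\<bar> / 2" using abs_half[OF that(2)] .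
      then show ?case using Suc.IH[OF that(1)] by simp
    qed
    have cl: "a \<in> carrier M" "b \<in> carrier M" "c \<in> carrier M" using s psum_closed by auto
    show ?case
    proof (cases "small c")
      case True
      then obtain d where "psum c c d" by (auto simp: small_def)
      then obtain x y where xy: "psum a a x" "psum b b y" "psum x y d"
        using psum_interchange[OF s s] by blast
      show ?thesis
        using halve[OF xy(3)] F1[OF xy(1)] F1[OF xy(2)] F1[OF \<open>psum c c d\<close>] by argo
    next
      case False
      have z: "psum c (neg c) unt" using psum_compl cl by blast
      \<comment> \<open>When \<open>a\<close> cannot be doubled, a + b = c is replaced by b + (1 -
        c) = 1 - a. There the right side can be doubled, and so can both summands.\<close>
      have big: "\<bar>\<psi> a + \<psi> b - \<psi> c\<bar> \<le> 2 * (1/2) ^ Suc n"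
        if s: "psum a b c" and na: "\<not> small a" for a b
      proof -
        have a: "a \<in> carrier M" using s psum_closed by auto
        obtain f where f: "psum b (neg c) f" "psum a f unt" using psum_assoc[OF s z] by blast
        have "f = neg a" using f(2) psum_one by blast
        then obtain d where d: "psum f f d"
          using small_neg_neg[OF a na] by (auto simp: small_def)
        obtain x y where xy: "psum b b x" "psum (neg c) (neg c) y" "psum x y d"
          using psum_interchange[OF f(1) f(1) d] by blast
        have "\<psi> a = 1 - \<psi> d / 2" using F2[OF na] d \<open>f = neg a\<close> by simp
        moreover have "\<psi> c = 1 - \<psi> y / 2" using F2[OF False xy(2)] .
        moreover have "\<psi> b = \<psi> x / 2" using F1[OF xy(1)] .
        ultimately have "\<bar>\<psi> a + \<psi> b - \<psi> c\<bar> = \<bar>\<psi> x + \<psi> y - \<psi> d\<bar> / 2" by argo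
        then show ?thesis using Suc.IH[OF xy(3)] by simp
      qed
      show ?thesis
      proof (cases "small a \<and> small b")
        case True
        then obtain a2 b2 z2 where d: "psum a a a2" "psum b b b2" "psum (neg c) (neg c) z2"
          using small_neg_neg[OF cl(3) False] unfolding small_def by blast
        \<comment> \<open>Both summands can be doubled but c cannot: with z = 1 - c the doubled
          identity is (1 - 2b) + (1 - 2z) = 2a, whose terms are genuine elements.\<close>
        have w: "psum (neg b2) (neg z2) a2" using complementary_doubles[OF s z d] .
        have "\<psi> c = 1 - \<psi> z2 / 2" using F2[OF False d(3)] .
        moreover have "\<psi> (neg b2) = 1 - \<psi> b2" "\<psi> (neg z2) = 1 - \<psi> z2"
          using neg d psum_closed by blast+
        ultimately show ?thesis
          using halve[OF w] F1[OF d(1)] F1[OF d(2)] by argo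
      next
        case False
        then show ?thesis using big[OF s] big[OF psum_commute[OF s]] by (auto simp: add.commute)
      qed
    qed
  qed
  have add: "\<psi> c = \<psi> a + \<psi> b" if "psum a b c" for a b c
    using zero_if_le_half_powers[OF add_bound[OF that]] by simp
  have mult_bound: "\<bar>\<psi> (a \<odot> b) - \<psi> a * \<psi> b\<bar> \<le> 1 * (1/2) ^ n"
    if "a \<in> carrier M" "b \<in> carrier M" for a b n
    using that
  proof (induction n arbitrary: a)
    case 0
    have "0 \<le> \<psi> a * \<psi> b" "\<psi> a * \<psi> b \<le> 1" using bd by (auto intro: mult_le_one)
    then show ?case using bd[of "a \<odot> b"] by auto
  next
    case (Suc n)
    note b = \<open>b \<in> carrier M\<close>
    \<comment> \<open>Only the left factor is doubled and \<open>b\<close> stays fixed. If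
      \<open>a\<close> is not small, its complement is, with the same defect up to sign.\<close>
    have small: "\<bar>\<psi> (a \<odot> b) - \<psi> a * \<psi> b\<bar> \<le> 1 * (1/2) ^ Suc n" if sa: "small a" for a
    proof -
      obtain d where d: "psum a a d" using sa by (auto simp: small_def)
      have "\<psi> d = 2 * \<psi> a" "\<psi> (d \<odot> b) = 2 * \<psi> (a \<odot> b)"
        using add[OF d] add[OF psum_mult[OF d b]] by auto
      then have "\<psi> (a \<odot> b) - \<psi> a * \<psi> b = (\<psi> (d \<odot> b) - \<psi> d * \<psi> b) / 2" by simp
      then show ?thesis using abs_half Suc.IH[OF psum_closed(3)[OF d] b] by fastforce
    qed
    have "\<psi> b = \<psi> (a \<odot> b) + \<psi> (neg a \<odot> b)" "\<psi> (neg a) = 1 - \<psi> a"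
      using add split_left neg Suc.prems by blast+
    then have "\<psi> (neg a \<odot> b) = \<psi> b - \<psi> (a \<odot> b)" "\<psi> (neg a) = 1 - \<psi> a" by simp_all
    then have "\<psi> (neg a \<odot> b) - \<psi> (neg a) * \<psi> b = - (\<psi> (a \<odot> b) - \<psi> a * \<psi> b)"
      by (simp only: left_diff_distrib)
    then have "\<bar>\<psi> (neg a \<odot> b) - \<psi> (neg a) * \<psi> b\<bar> = \<bar>\<psi> (a \<odot> b) - \<psi> a * \<psi> b\<bar>" by simp
    then show ?case
      using small[of a] small[of "neg a"] small_or_small_neg[OF Suc.prems(1)] by metis
  qed
  have mult: "\<psi> (a \<odot> b) = \<psi> a * \<psi> b" if "a \<in> carrier M" "b \<in> carrier M" for a b
    using zero_if_le_half_powers[OF mult_bound[OF that]] by simp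
  have "unit_hom (\<lambda>a. if a \<in> carrier M then \<psi> a else 0)"
    using \<psi>1 bd add mult psum_closed one_closed mult_closed
    unfolding unit_hom_def by auto
  then show ?thesis by blast
qed

end

section \<open>Germs along an ultrafilter of idempotents\<close>

context effect_monoid
begin

text \<open>An ultrafilter in the Boolean algebra of idempotents. Upward closure follows: if p in
  \<open>U\<close> lay below q with 1 - q in \<open>U\<close>, then p (1 - q) = 0 would be in
  \<open>U\<close>.\<close>

definition ultra :: "'a set \<Rightarrow> bool" where
  "ultra U \<longleftrightarrow> (\<forall>p\<in>U. idem p) \<and> eone M \<in> U \<and> ezero M \<notin> U \<and> (\<forall>p\<in>U. \<forall>q\<in>U. p \<odot> q \<in> U) \<and>
     (\<forall>p. idem p \<longrightarrow> p \<in> U \<or> neg p \<in> U)"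

text \<open>Zorn's lemma gives a maximal multiplicative family of idempotents that contains e and
  avoids 0. Maximality decides every idempotent, as an undecided p would give members u, v with u p
  = 0 and v (1 - p) = 0, hence u v = 0.\<close>

lemma ultra_exists:
  assumes e: "idem e" "e \<noteq> ezero M"
  obtains U where "ultra U" "e \<in> U"
proof -
  define \<A> where "\<A> = {U. (\<forall>p\<in>U. idem p) \<and> eone M \<in> U \<and> ezero M \<notin> U \<and>
    (\<forall>p\<in>U. \<forall>q\<in>U. p \<odot> q \<in> U) \<and> e \<in> U}"
  have "ezero M \<noteq> eone M"
    using e mult_one_left zero_mult idem_closed by metis
  moreover have "e \<odot> e = e" "eone M \<odot> e = e" "e \<odot> eone M = e" "eone M \<odot> eone M = eone M"
    using e idem_closed[OF e(1)] one_closed mult_one_left mult_one_right by (simp_all add: idem_def)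
  ultimately have "{eone M, e} \<in> \<A>"
    using e idem_one by (simp add: \<A>_def)
  moreover have "\<Union>\<C> \<in> \<A>" if ne: "\<C> \<noteq> {}" and ch: "subset.chain \<A> \<C>" for \<C>
  proof -
    have "\<C> \<subseteq> \<A>" using ch by (simp add: subset.chain_def)
    moreover have "p \<odot> q \<in> \<Union>\<C>" if pq: "p \<in> \<Union>\<C>" "q \<in> \<Union>\<C>" for p q
    proof -
      obtain C D where CD: "p \<in> C" "q \<in> D" "C \<in> \<C>" "D \<in> \<C>" using pq by blast
      then have "C \<subseteq> D \<or> D \<subseteq> C" using ch by (auto simp: subset_chain_def)
      then show ?thesis using CD \<open>\<C> \<subseteq> \<A>\<close> unfolding \<A>_def by blast
    qed
    ultimately show ?thesis using ne unfolding \<A>_def by blast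
  qed
  ultimately obtain U where U: "U \<in> \<A>" and max: "\<And>X. X \<in> \<A> \<Longrightarrow> U \<subseteq> X \<Longrightarrow> X = U"
    using subset_Zorn_nonempty[of \<A>] by blast
  have UD: "\<And>u. u \<in> U \<Longrightarrow> idem u" "\<And>u. u \<in> U \<Longrightarrow> u \<in> carrier M" "eone M \<in> U" "ezero M \<notin> U" "e \<in> U"
    "\<And>u v. u \<in> U \<Longrightarrow> v \<in> U \<Longrightarrow> u \<odot> v \<in> U"
    using U idem_closed by (auto simp: \<A>_def)
  have meet: "\<exists>u\<in>U. u \<odot> p = ezero M" if p: "idem p" "p \<notin> U" for p
  proof (rule ccontr)
    assume n: "\<not> (\<exists>u\<in>U. u \<odot> p = ezero M)"
    have pc: "p \<in> carrier M" using p idem_closed by blast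
    \<comment> \<open>The multiplicative family generated by \<open>U\<close> and p; it avoids 0
      unless some member of \<open>U\<close> annihilates p.\<close>
    define V where "V = U \<union> (\<lambda>u. u \<odot> p) ` U"
    have 1: "u \<odot> (v \<odot> p) = u \<odot> v \<odot> p" if "u \<in> U" "v \<in> U" for u v
      using that UD(2) pc mult_assoc by simp
    have 2: "u \<odot> p \<odot> v = u \<odot> v \<odot> p" if "u \<in> U" "v \<in> U" for u v
      using that UD(2) pc mult_assoc idem_central[OF p(1)] by simp
    have 3: "u \<odot> p \<odot> (v \<odot> p) = u \<odot> v \<odot> p" if "u \<in> U" "v \<in> U" for u v
    proof -
      have "u \<odot> p \<odot> (v \<odot> p) = u \<odot> (p \<odot> v \<odot> p)" using that UD(2) pc mult_assoc mult_closed by simp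
      also have "\<dots> = u \<odot> (v \<odot> (p \<odot> p))"
        using that UD(2) pc mult_assoc idem_central[OF p(1), of v] by simp
      finally show ?thesis using p that UD(2) mult_assoc by (simp add: idem_def)
    qed
    have "ezero M \<notin> V" using n UD(4) unfolding V_def by force
    moreover have "\<forall>p\<in>V. idem p" using UD(1) p(1) idem_mult by (auto simp: V_def)
    moreover have "\<forall>u\<in>V. \<forall>v\<in>V. u \<odot> v \<in> V" using UD(6) by (auto simp: V_def 1 2 3)
    ultimately have "V \<in> \<A>" using UD(3,5) by (simp add: \<A>_def V_def)
    then have "V = U" using max by (simp add: V_def)
    moreover have "eone M \<odot> p \<in> V" using UD(3) by (simp add: V_def)
    ultimately show False using p pc mult_one_left by simp
  qed
  have "p \<in> U \<or> neg p \<in> U" if p: "idem p" for p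
  proof (rule ccontr)
    assume "\<not> (p \<in> U \<or> neg p \<in> U)"
    then obtain u v where uv: "u \<in> U" "v \<in> U" "u \<odot> p = ezero M" "v \<odot> neg p = ezero M"
      using meet p idem_neg by meson
    have c: "u \<in> carrier M" "v \<in> carrier M" "p \<in> carrier M" "neg p \<in> carrier M"
      using uv UD(2) p idem_closed compl_closed by auto
    have "u \<odot> v \<odot> p = ezero M"
      using c uv idem_central[OF p] mult_assoc zero_mult by metis
    moreover have "u \<odot> v \<odot> neg p = ezero M" using c uv mult_assoc mult_zero by simp
    ultimately have "psum (ezero M) (ezero M) (u \<odot> v)"
      using split_right[of "u \<odot> v" p] c mult_closed by simp
    then have "u \<odot> v = ezero M" using psum_zero zero_closed psum_unique by blast
    then show False using uv UD(4,6) by metis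
  qed
  then have "ultra U" using UD by (simp add: ultra_def)
  then show ?thesis using that UD(5) by blast
qed

lemma idem_mult_distrib:
  assumes "idem p" "a \<in> carrier M" "b \<in> carrier M"
  shows "a \<odot> b \<odot> p = a \<odot> p \<odot> (b \<odot> p)"
proof -
  have c: "p \<in> carrier M" using assms idem_closed by blast
  have "a \<odot> p \<odot> (b \<odot> p) = a \<odot> (p \<odot> b) \<odot> p" using assms c mult_assoc mult_closed by simp
  also have "\<dots> = a \<odot> b \<odot> (p \<odot> p)" using assms c mult_assoc mult_closed idem_central by simp
  finally show ?thesis using assms(1) by (simp add: idem_def)
qed

text \<open>The germ of an element along \<open>U\<close> is represented by a chosen member of its class, so that
  the quotient again lives on the type \<open>'a\<close>.\<close>

definition germ_eq :: "'a set \<Rightarrow> 'a \<Rightarrow> 'a \<Rightarrow> bool" where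
  "germ_eq U a b \<longleftrightarrow> a \<in> carrier M \<and> b \<in> carrier M \<and> (\<exists>p\<in>U. a \<odot> p = b \<odot> p)"

definition germ :: "'a set \<Rightarrow> 'a \<Rightarrow> 'a" where
  "germ U a = (SOME b. germ_eq U a b)"

text \<open>The sum is only required on some member of \<open>U\<close>, so two germs may be
  summable although their representatives are not.\<close>

definition germ_sum :: "'a set \<Rightarrow> 'a \<Rightarrow> 'a \<Rightarrow> 'a \<Rightarrow> bool" where
  "germ_sum U a b c \<longleftrightarrow> a \<in> carrier M \<and> b \<in> carrier M \<and> c \<in> carrier M \<and>
     (\<exists>p\<in>U. psum (a \<odot> p) (b \<odot> p) (c \<odot> p))"

text \<open>Results are normalised by \<open>germ\<close>. The choice of a sum does not affect the
  outcome, since germ sums are unique up to \<open>germ_eq\<close>.\<close>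

definition germ_monoid :: "'a set \<Rightarrow> 'a effect_monoid" where
  "germ_monoid U =
     \<lparr>carrier = germ U ` carrier M,
      ezero = germ U (ezero M),
      eplus = (\<lambda>a b. if \<exists>c. germ_sum U a b c then Some (germ U (SOME c. germ_sum U a b c)) else None),
      ecompl = (\<lambda>a. germ U (neg a)),
      emult = (\<lambda>a b. germ U (a \<odot> b))\<rparr>"

section \<open>Compatibility of the operations with germs\<close>

context
  fixes U assumes U: "ultra U"
begin

lemma ultra_idem: "p \<in> U \<Longrightarrow> idem p"
  using U by (simp add: ultra_def)

lemma ultra_closed: "p \<in> U \<Longrightarrow> p \<in> carrier M"
  using ultra_idem idem_closed by blast

lemma ultra_one: "eone M \<in> U"
  using U by (simp add: ultra_def)

lemma ultra_mult: "p \<in> U \<Longrightarrow> q \<in> U \<Longrightarrow> p \<odot> q \<in> U"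
  using U by (simp add: ultra_def)

text \<open>Agreement on p persists on any refinement. The two product orders let witnesses p and q
  be replaced by the single witness p q.\<close>

lemma eq_at_mult:
  assumes "a \<odot> p = b \<odot> p" "p \<in> U" "q \<in> U" "a \<in> carrier M" "b \<in> carrier M"
  shows "a \<odot> (p \<odot> q) = b \<odot> (p \<odot> q)" "a \<odot> (q \<odot> p) = b \<odot> (q \<odot> p)"
proof -
  show 1: "a \<odot> (p \<odot> q) = b \<odot> (p \<odot> q)"
    using assms mult_assoc ultra_closed by metis
  have "p \<odot> q = q \<odot> p" using assms(2,3) ultra_idem ultra_closed idem_central by blast
  then show "a \<odot> (q \<odot> p) = b \<odot> (q \<odot> p)" using 1 by simp
qed

lemma psum_at_mult:
  assumes "psum (a \<odot> p) (b \<odot> p) (c \<odot> p)" "p \<in> U" "q \<in> U" "a \<in> carrier M" "b \<in> carrier M" "c \<in> carrier M"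
  shows "psum (a \<odot> (p \<odot> q)) (b \<odot> (p \<odot> q)) (c \<odot> (p \<odot> q))"
    "psum (a \<odot> (q \<odot> p)) (b \<odot> (q \<odot> p)) (c \<odot> (q \<odot> p))"
proof -
  show 1: "psum (a \<odot> (p \<odot> q)) (b \<odot> (p \<odot> q)) (c \<odot> (p \<odot> q))"
    using psum_mult[OF assms(1) ultra_closed[OF assms(3)]] assms mult_assoc ultra_closed by simp
  have "p \<odot> q = q \<odot> p" using assms(2,3) ultra_idem ultra_closed idem_central by blast
  then show "psum (a \<odot> (q \<odot> p)) (b \<odot> (q \<odot> p)) (c \<odot> (q \<odot> p))" using 1 by simp
qed

lemma germ_eq_refl: "a \<in> carrier M \<Longrightarrow> germ_eq U a a"
  using ultra_one by (auto simp: germ_eq_def)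

lemma germ_eq_sym: "germ_eq U a b \<Longrightarrow> germ_eq U b a"
  unfolding germ_eq_def by metis

lemma germ_eq_trans:
  assumes "germ_eq U a b" "germ_eq U b c"
  shows "germ_eq U a c"
proof -
  obtain p q where pq: "p \<in> U" "q \<in> U" "a \<odot> p = b \<odot> p" "b \<odot> q = c \<odot> q"
    and c: "a \<in> carrier M" "b \<in> carrier M" "c \<in> carrier M"
    using assms by (auto simp: germ_eq_def)
  have "a \<odot> (p \<odot> q) = c \<odot> (p \<odot> q)"
    using eq_at_mult(1)[OF pq(3,1,2)] eq_at_mult(2)[OF pq(4,2,1)] c by simp
  then show ?thesis using c pq ultra_mult unfolding germ_eq_def by blast
qed

lemma germ_eq_germ: "a \<in> carrier M \<Longrightarrow> germ_eq U a (germ U a)"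
  unfolding germ_def by (rule someI[of "germ_eq U a" a], rule germ_eq_refl)

lemma germ_eqI: "germ_eq U a b \<Longrightarrow> germ U a = germ U b"
proof -
  assume "germ_eq U a b"
  then have "germ_eq U a = germ_eq U b" using germ_eq_sym germ_eq_trans by blast
  then show ?thesis by (simp add: germ_def)
qed

lemma germ_eqD: "germ U a = germ U b \<Longrightarrow> a \<in> carrier M \<Longrightarrow> b \<in> carrier M \<Longrightarrow> germ_eq U a b"
  using germ_eq_germ germ_eq_sym germ_eq_trans by metis

lemma germ_eq_mult:
  assumes "germ_eq U a a'" "germ_eq U b b'"
  shows "germ_eq U (a \<odot> b) (a' \<odot> b')"
proof -
  obtain p q where pq: "p \<in> U" "q \<in> U" "a \<odot> p = a' \<odot> p" "b \<odot> q = b' \<odot> q"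
    and c: "a \<in> carrier M" "b \<in> carrier M" "a' \<in> carrier M" "b' \<in> carrier M"
    using assms by (auto simp: germ_eq_def)
  let ?r = "p \<odot> q"
  have r: "?r \<in> U" using pq ultra_mult by blast
  have "a \<odot> ?r = a' \<odot> ?r" "b \<odot> ?r = b' \<odot> ?r"
    using eq_at_mult(1)[OF pq(3,1,2)] eq_at_mult(2)[OF pq(4,2,1)] c by auto
  then have "a \<odot> b \<odot> ?r = a' \<odot> b' \<odot> ?r"
    using idem_mult_distrib[OF ultra_idem[OF r]] c by simp
  then show ?thesis using r c mult_closed unfolding germ_eq_def by blast
qed

lemma neg_at:
  assumes "a \<in> carrier M" "p \<in> U"
  shows "psum (a \<odot> p) (neg a \<odot> p) p"
  using split_left[OF ultra_closed[OF assms(2)] assms(1)] .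

lemma germ_eq_neg:
  assumes "germ_eq U a b"
  shows "germ_eq U (neg a) (neg b)"
proof -
  obtain p where p: "p \<in> U" "a \<odot> p = b \<odot> p" and c: "a \<in> carrier M" "b \<in> carrier M"
    using assms by (auto simp: germ_eq_def)
  have "neg a \<odot> p = neg b \<odot> p"
    using neg_at[OF c(1) p(1)] neg_at[OF c(2) p(1)] p(2) psum_cancel by metis
  then show ?thesis using p c compl_closed unfolding germ_eq_def by blast
qed

lemma germ_sum_closed:
  assumes "germ_sum U a b c"
  shows "a \<in> carrier M" "b \<in> carrier M" "c \<in> carrier M"
  using assms by (auto simp: germ_sum_def)

lemma germ_sumI: "psum a b c \<Longrightarrow> germ_sum U a b c"
  unfolding germ_sum_def using psum_mult psum_closed ultra_one ultra_closed by blast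

lemma germ_sum_commute: "germ_sum U a b c \<Longrightarrow> germ_sum U b a c"
  unfolding germ_sum_def using psum_commute by blast

lemma germ_sum_unique:
  assumes "germ_sum U a b c" "germ_sum U a b d"
  shows "germ_eq U c d"
proof -
  obtain p q where pq: "p \<in> U" "q \<in> U" "psum (a \<odot> p) (b \<odot> p) (c \<odot> p)" "psum (a \<odot> q) (b \<odot> q) (d \<odot> q)"
    using assms by (auto simp: germ_sum_def)
  have "c \<odot> (p \<odot> q) = d \<odot> (p \<odot> q)"
    using psum_at_mult(1)[OF pq(3,1,2)] psum_at_mult(2)[OF pq(4,2,1)] germ_sum_closed assms psum_unique
    by metis
  then show ?thesis using pq ultra_mult germ_sum_closed assms unfolding germ_eq_def by blast
qed

lemma germ_sum_cong:
  assumes "germ_sum U a b c" "germ_eq U a a'" "germ_eq U b b'" "germ_eq U c c'"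
  shows "germ_sum U a' b' c'"
proof -
    obtain p where p: "p \<in> U" "psum (a \<odot> p) (b \<odot> p) (c \<odot> p)" using assms(1) by (auto simp: germ_sum_def)
  obtain q1 q2 q3 where q: "q1 \<in> U" "q2 \<in> U" "q3 \<in> U"
    "a \<odot> q1 = a' \<odot> q1" "b \<odot> q2 = b' \<odot> q2" "c \<odot> q3 = c' \<odot> q3"
    using assms by (auto simp: germ_eq_def)
  have cl: "a \<in> carrier M" "b \<in> carrier M" "c \<in> carrier M"
    "a' \<in> carrier M" "b' \<in> carrier M" "c' \<in> carrier M"
    using assms by (auto simp: germ_eq_def)
  define u where "u = q1 \<odot> q2"
  define v where "v = u \<odot> q3"
  have m: "u \<in> U" "v \<in> U" "p \<odot> v \<in> U" using p q ultra_mult by (auto simp: u_def v_def)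
  have 1: "a \<odot> u = a' \<odot> u" "b \<odot> u = b' \<odot> u"
    unfolding u_def using eq_at_mult(1)[OF q(4,1,2)] eq_at_mult(2)[OF q(5,2,1)] cl by auto
  have 2: "a \<odot> v = a' \<odot> v" "b \<odot> v = b' \<odot> v" "c \<odot> v = c' \<odot> v"
    unfolding v_def using eq_at_mult(1)[OF 1(1) m(1) q(3)] eq_at_mult(1)[OF 1(2) m(1) q(3)]
      eq_at_mult(2)[OF q(6,3) m(1)] cl by auto
  have "a \<odot> (p \<odot> v) = a' \<odot> (p \<odot> v)" "b \<odot> (p \<odot> v) = b' \<odot> (p \<odot> v)"
    "c \<odot> (p \<odot> v) = c' \<odot> (p \<odot> v)"
    using eq_at_mult(2)[OF 2(1) m(2) p(1)] eq_at_mult(2)[OF 2(2) m(2) p(1)]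
      eq_at_mult(2)[OF 2(3) m(2) p(1)] cl by auto
  then have "psum (a' \<odot> (p \<odot> v)) (b' \<odot> (p \<odot> v)) (c' \<odot> (p \<odot> v))"
    using psum_at_mult(1)[OF p(2,1) m(2)] cl by simp
  then show ?thesis using m(3) cl unfolding germ_sum_def by blast
qed

lemma germ_sum_assoc:
  assumes "germ_sum U a b d" "germ_sum U d c e"
  obtains f where "germ_sum U b c f" "germ_sum U a f e"
proof -
  obtain p q where pq: "p \<in> U" "q \<in> U" "psum (a \<odot> p) (b \<odot> p) (d \<odot> p)" "psum (d \<odot> q) (c \<odot> q) (e \<odot> q)"
    using assms by (auto simp: germ_sum_def)
  let ?r = "p \<odot> q"
  have r: "?r \<in> U" using pq ultra_mult by blast
  have cl: "a \<in> carrier M" "b \<in> carrier M" "c \<in> carrier M" "d \<in> carrier M" "e \<in> carrier M" "?r \<in> carrier M"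
    using germ_sum_closed assms r ultra_closed by auto
  have "psum (a \<odot> ?r) (b \<odot> ?r) (d \<odot> ?r)" "psum (d \<odot> ?r) (c \<odot> ?r) (e \<odot> ?r)"
    using psum_at_mult(1)[OF pq(3,1,2)] psum_at_mult(2)[OF pq(4,2,1)] cl by auto
  then obtain f where f: "psum (b \<odot> ?r) (c \<odot> ?r) f" "psum (a \<odot> ?r) f (e \<odot> ?r)"
    using psum_assoc by blast
  have fc: "f \<in> carrier M" using f psum_closed by blast
  have rr: "x \<odot> ?r \<odot> ?r = x \<odot> ?r" if "x \<in> carrier M" for x
    using that cl mult_assoc ultra_idem[OF r] by (simp add: idem_def)
  \<comment> \<open>\<open>f\<close> is a sum of two elements fixed by this idempotent, so it is
    fixed as well and equals its own restriction.\<close>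
  have "f \<odot> ?r = f"
    using psum_mult[OF f(1) cl(6)] f(1) rr cl psum_unique by simp
  then have "psum (b \<odot> ?r) (c \<odot> ?r) (f \<odot> ?r)" "psum (a \<odot> ?r) (f \<odot> ?r) (e \<odot> ?r)"
    using f by auto
  then have "germ_sum U b c f" "germ_sum U a f e"
    using fc cl r unfolding germ_sum_def by blast+
  then show ?thesis using that by blast
qed

section \<open>The quotient effect monoid of germs\<close>

lemma germ_monoid_simps:
  "carrier (germ_monoid U) = germ U ` carrier M"
  "ezero (germ_monoid U) = germ U (ezero M)"
  "ecompl (germ_monoid U) a = germ U (neg a)"
  "emult (germ_monoid U) a b = germ U (a \<odot> b)"
  by (simp_all add: germ_monoid_def)

lemma germ_monoid_plus:
  "eplus (germ_monoid U) a b = Some z \<longleftrightarrow> (\<exists>c. germ_sum U a b c \<and> z = germ U c)"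
proof -
  have "germ U (SOME c. germ_sum U a b c) = germ U c" if "germ_sum U a b c" for c
    using that germ_sum_unique germ_eqI someI by metis
  then show ?thesis by (auto simp: germ_monoid_def)
qed

lemma germ_monoid_one: "eone (germ_monoid U) = germ U (eone M)"
  using germ_eqI[OF germ_eq_neg[OF germ_eq_germ[OF zero_closed]]]
  by (simp add: eone_def germ_monoid_simps)

lemma germ_monoid_plus_germ:
  assumes "germ_sum U a b c"
  shows "eplus (germ_monoid U) (germ U a) (germ U b) = Some (germ U c)"
  unfolding germ_monoid_plus
  using germ_sum_cong[OF assms germ_eq_germ germ_eq_germ germ_eq_refl] germ_sum_closed[OF assms]
  by blast

lemma germ_monoid_plus_germD:
  assumes "eplus (germ_monoid U) (germ U a) (germ U b) = Some z" "a \<in> carrier M" "b \<in> carrier M"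
  obtains c where "germ_sum U a b c" "z = germ U c"
proof -
  obtain c where c: "germ_sum U (germ U a) (germ U b) c" "z = germ U c"
    using assms(1) by (auto simp: germ_monoid_plus)
  have "germ_sum U a b c"
    using germ_sum_cong[OF c(1) germ_eq_sym[OF germ_eq_germ[OF assms(2)]]
        germ_eq_sym[OF germ_eq_germ[OF assms(3)]] germ_eq_refl[OF germ_sum_closed(3)[OF c(1)]]] .
  then show ?thesis using that c(2) by blast
qed

lemma germ_monoid_mult_germ:
  "a \<in> carrier M \<Longrightarrow> b \<in> carrier M \<Longrightarrow>
    emult (germ_monoid U) (germ U a) (germ U b) = germ U (a \<odot> b)"
  using germ_eqI[OF germ_eq_mult] germ_eq_germ germ_eq_sym by (simp add: germ_monoid_simps)

lemma germ_monoid_compl_germ: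
  "a \<in> carrier M \<Longrightarrow> ecompl (germ_monoid U) (germ U a) = germ U (neg a)"
  using germ_eqI[OF germ_eq_neg] germ_eq_germ germ_eq_sym by (simp add: germ_monoid_simps)

text \<open>Each law is moved to representatives; where sums are involved it is checked on a member
  of \<open>U\<close>, where it is an identity of \<open>M\<close>.\<close>

lemma germ_monoid_effect_monoid: "effect_monoid (germ_monoid U)"
proof (unfold_locales, unfold germ_monoid_simps(1,2) germ_monoid_one)
  let ?Q = "germ_monoid U"
  let ?C = "germ U ` carrier M"
  show "germ U nul \<in> ?C" using zero_closed by blast
  fix a assume "a \<in> ?C"
  then obtain a' where a: "a = germ U a'" "a' \<in> carrier M" by blast
  show "ecompl ?Q a \<in> ?C" using a germ_monoid_compl_germ compl_closed by auto
  show "eplus ?Q a (germ U nul) = Some a"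
    using a germ_monoid_plus_germ[OF germ_sumI[OF psum_zero]] by simp
  show "eplus ?Q a (ecompl ?Q a) = Some (germ U unt)"
    using a germ_monoid_plus_germ[OF germ_sumI[OF psum_compl]] germ_monoid_compl_germ by simp
  show "emult ?Q (germ U unt) a = a" "emult ?Q a (germ U unt) = a"
    using a one_closed germ_monoid_mult_germ mult_one_left mult_one_right by auto
  show "a = germ U nul" if ne: "eplus ?Q a (germ U unt) \<noteq> None"
  proof -
    obtain z where "eplus ?Q (germ U a') (germ U unt) = Some z" using ne a by auto
    then obtain c where "germ_sum U a' unt c"
      using a(2) one_closed germ_monoid_plus_germD by blast
    then obtain p where p: "p \<in> U" "psum (a' \<odot> p) p (c \<odot> p)" and c: "c \<in> carrier M"
      using mult_one_left ultra_closed by (auto simp: germ_sum_def)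
    \<comment> \<open>A sum p + a' p that stays below p must equal p, so a' vanishes on p.\<close>
    have "c \<odot> p = p"
      using p psum_leq leq_antisym mult_leq_right[OF c ultra_closed[OF p(1)]] by blast
    then have "a' \<odot> p = nul" using p psum_commute psum_eq_left by metis
    then have "germ_eq U a' nul"
      using p a zero_closed zero_mult ultra_closed unfolding germ_eq_def by metis
    then show ?thesis using a germ_eqI by simp
  qed
  fix b assume "b \<in> ?C"
  then obtain b' where b: "b = germ U b'" "b' \<in> carrier M" by blast
  show "emult ?Q a b \<in> ?C" using a b germ_monoid_mult_germ mult_closed by auto
  have "germ_sum U a b = germ_sum U b a" using germ_sum_commute by blast
  then show "eplus ?Q a b = eplus ?Q b a" by (simp add: germ_monoid_def)
  show "c \<in> ?C" if "eplus ?Q a b = Some c" for c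
    using that germ_sum_closed by (auto simp: germ_monoid_plus)
  show "b = ecompl ?Q a" if s: "eplus ?Q a b = Some (germ U unt)"
  proof -
    obtain c where c: "germ_sum U a' b' c" "germ U unt = germ U c"
      using s a b germ_monoid_plus_germD by blast
    have "germ_eq U c unt" using germ_eqD[OF c(2)[symmetric]] germ_sum_closed[OF c(1)] one_closed by blast
    then have "germ_sum U a' b' unt"
      using germ_sum_cong[OF c(1) germ_eq_refl germ_eq_refl] a b by blast
    then obtain p where p: "p \<in> U" "psum (a' \<odot> p) (b' \<odot> p) p"
      using mult_one_left ultra_closed by (auto simp: germ_sum_def)
    then have "b' \<odot> p = neg a' \<odot> p" using neg_at[OF a(2)] psum_cancel by blast
    then have "germ_eq U b' (neg a')" using p a b compl_closed unfolding germ_eq_def by blast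
    then show ?thesis using a b germ_eqI germ_monoid_compl_germ by simp
  qed
  fix c assume "c \<in> ?C"
  then obtain c' where c: "c = germ U c'" "c' \<in> carrier M" by blast
  show "emult ?Q (emult ?Q a b) c = emult ?Q a (emult ?Q b c)"
    using a b c germ_monoid_mult_germ mult_closed mult_assoc by simp
  show "\<exists>f. eplus ?Q b c = Some f \<and> eplus ?Q a f = Some e"
    if de: "eplus ?Q a b = Some d" "eplus ?Q d c = Some e" for d e
  proof -
    obtain d' where d: "germ_sum U a' b' d'" "d = germ U d'"
      using de(1) a b germ_monoid_plus_germD by blast
    obtain e' where e: "germ_sum U d' c' e'" "e = germ U e'"
      using de(2) d(2) c germ_sum_closed(3)[OF d(1)] germ_monoid_plus_germD by blast
    obtain f where "germ_sum U b' c' f" "germ_sum U a' f e'" using germ_sum_assoc d e by blast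
    then show ?thesis using germ_monoid_plus_germ a b c e by blast
  qed
  fix d assume "eplus ?Q b c = Some d"
  then obtain d' where d: "germ_sum U b' c' d'" "d = germ U d'"
    using b c germ_monoid_plus_germD by blast
  then obtain p where p: "p \<in> U" "psum (b' \<odot> p) (c' \<odot> p) (d' \<odot> p)" and dc: "d' \<in> carrier M"
    by (auto simp: germ_sum_def)
  have pc: "p \<in> carrier M" and ip: "idem p" using p ultra_closed ultra_idem by auto
  have "psum (a' \<odot> b' \<odot> p) (a' \<odot> c' \<odot> p) (a' \<odot> d' \<odot> p)"
    using mult_psum[OF p(2) a(2)] pc a b c dc mult_assoc by simp
  then have "germ_sum U (a' \<odot> b') (a' \<odot> c') (a' \<odot> d')"
    using p(1) a b c dc mult_closed unfolding germ_sum_def by blast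
  then show "eplus ?Q (emult ?Q a b) (emult ?Q a c) = Some (emult ?Q a d)"
    using germ_monoid_plus_germ germ_monoid_mult_germ a b c d dc by simp
  have "psum (b' \<odot> p \<odot> a') (c' \<odot> p \<odot> a') (d' \<odot> p \<odot> a')" using psum_mult[OF p(2) a(2)] .
  moreover have "x \<odot> p \<odot> a' = x \<odot> a' \<odot> p" if "x \<in> carrier M" for x
    using that pc a mult_assoc idem_central[OF ip] by simp
  ultimately have "psum (b' \<odot> a' \<odot> p) (c' \<odot> a' \<odot> p) (d' \<odot> a' \<odot> p)"
    using b c dc by simp
  then have "germ_sum U (b' \<odot> a') (c' \<odot> a') (d' \<odot> a')"
    using p(1) a b c dc mult_closed unfolding germ_sum_def by blast
  then show "eplus ?Q (emult ?Q b a) (emult ?Q c a) = Some (emult ?Q d a)"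
    using germ_monoid_plus_germ germ_monoid_mult_germ a b c d dc by simp
qed

lemma germ_monoid_nontrivial: "ezero (germ_monoid U) \<noteq> eone (germ_monoid U)"
proof
  assume "ezero (germ_monoid U) = eone (germ_monoid U)"
  then have "germ_eq U nul unt"
    using germ_eqD zero_closed one_closed by (simp add: germ_monoid_simps germ_monoid_one)
  then obtain p where "p \<in> U" "nul \<odot> p = unt \<odot> p" by (auto simp: germ_eq_def)
  then have "nul \<in> U" using zero_mult mult_one_left ultra_closed by metis
  then show False using U by (simp add: ultra_def)
qed

end

end

section \<open>Homomorphisms into the unit interval\<close>

context effect_monoid
begin

lemma
  assumes "unit_hom \<phi>"
  shows unit_hom_one: "\<phi> unt = 1"
    and unit_hom_nonneg: "0 \<le> \<phi> a"
    and unit_hom_outside: "a \<notin> carrier M \<Longrightarrow> \<phi> a = 0"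
    and unit_hom_psum: "psum a b c \<Longrightarrow> \<phi> c = \<phi> a + \<phi> b"
    and unit_hom_mult: "a \<in> carrier M \<Longrightarrow> b \<in> carrier M \<Longrightarrow> \<phi> (a \<odot> b) = \<phi> a * \<phi> b"
  using assms unfolding unit_hom_def by blast+

lemma unit_hom_mono: "unit_hom \<phi> \<Longrightarrow> leq a b \<Longrightarrow> \<phi> a \<le> \<phi> b"
  using unit_hom_psum unit_hom_nonneg by (fastforce simp: leq_def)

lemma unit_hom_le_one: "unit_hom \<phi> \<Longrightarrow> \<phi> a \<le> 1"
  using unit_hom_mono[OF _ leq_one] unit_hom_one unit_hom_outside by (metis zero_le_one)

lemma unit_hom_neg: "unit_hom \<phi> \<Longrightarrow> a \<in> carrier M \<Longrightarrow> \<phi> (neg a) = 1 - \<phi> a"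
  using unit_hom_psum[OF _ psum_compl] unit_hom_one by fastforce

lemma unit_hom_zero: "unit_hom \<phi> \<Longrightarrow> \<phi> nul = 0"
  using unit_hom_psum[OF _ psum_zero[OF zero_closed]] by fastforce

lemma unit_hom_idem:
  assumes "unit_hom \<phi>" "idem p"
  shows "\<phi> p = 0 \<or> \<phi> p = 1"
proof -
  have "\<phi> p * \<phi> p = \<phi> p"
    using unit_hom_mult[OF assms(1), of p p] assms(2) by (simp add: idem_def)
  then show ?thesis by simp
qed

lemma unit_hom_mult_eq_one:
  assumes "unit_hom \<phi>" "idem p" "idem q"
  shows "\<phi> (p \<odot> q) = 1 \<longleftrightarrow> \<phi> p = 1 \<and> \<phi> q = 1"
  using unit_hom_mult[OF assms(1)] unit_hom_idem[OF assms(1)] assms(2,3) idem_closed by fastforce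

text \<open>Multiplying the sum by p fixes its two other terms, so cancellation fixes c. The
  difference of two restrictions to p thus lives on p.\<close>

lemma psum_absorb_idem:
  assumes s: "psum (a \<odot> p) c (b \<odot> p)" and p: "idem p" and "a \<in> carrier M" "b \<in> carrier M"
  shows "c \<odot> p = c"
proof -
  have "x \<odot> p \<odot> p = x \<odot> p" if "x \<in> carrier M" for x
    using that p idem_closed[OF p] mult_assoc by (simp add: idem_def)
  then have "psum (a \<odot> p) (c \<odot> p) (b \<odot> p)"
    using psum_mult[OF s idem_closed[OF p]] assms(3,4) by simp
  then show ?thesis using s psum_cancel by blast
qed

definition join where "join p q = neg (neg p \<odot> neg q)"

lemma idem_join: "idem p \<Longrightarrow> idem q \<Longrightarrow> idem (join p q)"
  by (simp add: join_def idem_neg idem_mult)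

lemma leq_join:
  assumes "idem p" "idem q"
  shows "leq p (join p q)"
proof -
  have "leq (neg p \<odot> neg q) (neg p)"
    using assms idem_closed compl_closed mult_leq_left by blast
  then have "leq (neg (neg p)) (join p q)" unfolding join_def by (rule leq_compl)
  then show ?thesis using assms idem_closed compl_compl by simp
qed

lemma unit_hom_join_eq_one:
  assumes \<phi>: "unit_hom \<phi>" and pq: "idem p" "idem q"
  shows "\<phi> (join p q) = 1 \<longleftrightarrow> \<phi> p = 1 \<or> \<phi> q = 1"
proof -
  have "\<phi> (join p q) = 1 - (1 - \<phi> p) * (1 - \<phi> q)"
    using assms idem_closed compl_closed mult_closed unit_hom_neg unit_hom_mult
    by (simp add: join_def)
  then show ?thesis by simp
qed

end

section \<open>Enough homomorphisms, and their local behaviour\<close>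

context omega_effect_monoid
begin

text \<open>An inequality on a member of \<open>U\<close> is an inequality of germs. As
  \<open>U\<close> contains p or 1 - p, comparability makes the germs linearly ordered, and their
  homomorphism is pulled back.\<close>

lemma ultra_leq_hom:
  assumes U: "ultra U"
  obtains \<phi> where "unit_hom \<phi>"
    "\<And>a b q. q \<in> U \<Longrightarrow> a \<in> carrier M \<Longrightarrow> b \<in> carrier M \<Longrightarrow> leq (a \<odot> q) (b \<odot> q) \<Longrightarrow> \<phi> a \<le> \<phi> b"
proof -
  interpret Q: effect_monoid "germ_monoid U" by (rule germ_monoid_effect_monoid[OF U])
  note simps = germ_monoid_simps
  have sum: "Q.psum (germ U a) (germ U b) (germ U c)" if "germ_sum U a b c" for a b c
    using germ_monoid_plus_germ[OF U that] germ_sum_closed[OF U that]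
    by (simp add: Q.psum_def simps[OF U])
  have le: "Q.leq (germ U a) (germ U b)"
    if q: "q \<in> U" and c: "a \<in> carrier M" "b \<in> carrier M" and l: "leq (a \<odot> q) (b \<odot> q)" for a b q
  proof -
    obtain x where x: "psum (a \<odot> q) x (b \<odot> q)" using l by (auto simp: leq_def)
    then have "x \<odot> q = x" using psum_absorb_idem ultra_idem[OF U q] c by blast
    then have "germ_sum U a x b"
      using x q c psum_closed(2)[OF x] unfolding germ_sum_def by metis
    then show ?thesis using sum by (auto simp: Q.leq_def)
  qed
  interpret Q: linear_effect_monoid "germ_monoid U"
  proof
    show "ezero (germ_monoid U) \<noteq> eone (germ_monoid U)" by (rule germ_monoid_nontrivial[OF U])
    fix x y assume "x \<in> carrier (germ_monoid U)" "y \<in> carrier (germ_monoid U)"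
    then obtain a b where ab: "x = germ U a" "y = germ U b" "a \<in> carrier M" "b \<in> carrier M"
      by (auto simp: simps[OF U])
    obtain p where p: "idem p" "leq (a \<odot> p) (b \<odot> p)" "leq (b \<odot> neg p) (a \<odot> neg p)"
      using comparability[OF ab(3,4)] by blast
    have "p \<in> U \<or> neg p \<in> U" using U p(1) by (simp add: ultra_def)
    then show "Q.leq x y \<or> Q.leq y x" using le p ab by blast
  qed
  obtain \<psi> where \<psi>: "Q.unit_hom \<psi>" using Q.unit_hom_exists by blast
  define \<phi> where "\<phi> a = (if a \<in> carrier M then \<psi> (germ U a) else 0)" for a
  have "\<phi> unt = 1"
    using Q.unit_hom_one[OF \<psi>] one_closed by (simp add: \<phi>_def germ_monoid_one[OF U])
  moreover have "\<phi> c = \<phi> a + \<phi> b" if "psum a b c" for a b c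
    using Q.unit_hom_psum[OF \<psi> sum[OF germ_sumI[OF U that]]] psum_closed[OF that]
    by (simp add: \<phi>_def)
  moreover have "\<phi> (a \<odot> b) = \<phi> a * \<phi> b" if "a \<in> carrier M" "b \<in> carrier M" for a b
    using Q.unit_hom_mult[OF \<psi>, of "germ U a" "germ U b"] that mult_closed
      germ_monoid_mult_germ[OF U that] by (simp add: \<phi>_def simps(1)[OF U])
  ultimately have "unit_hom \<phi>"
    using Q.unit_hom_nonneg[OF \<psi>] unfolding unit_hom_def by (simp add: \<phi>_def)
  then show ?thesis
    using that Q.unit_hom_mono[OF \<psi> le] by (simp add: \<phi>_def)
qed

text \<open>An element x killed by all homomorphisms can be doubled: were 1 - x \<le> x on a nonzero
  idempotent, an ultrafilter through it would give 1 \<le> 0. The double is killed too, so all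
  iterated doubles exist and the element is 0.\<close>

lemma unit_hom_nonzero:
  assumes c: "c \<in> carrier M" "c \<noteq> nul"
  shows "\<exists>\<phi>. unit_hom \<phi> \<and> \<phi> c \<noteq> 0"
proof (rule ccontr)
  assume n: "\<not> (\<exists>\<phi>. unit_hom \<phi> \<and> \<phi> c \<noteq> 0)"
  let ?P = "\<lambda>(n::nat) x. (n = 0 \<longrightarrow> x = c) \<and> x \<in> carrier M \<and> (\<forall>\<phi>. unit_hom \<phi> \<longrightarrow> \<phi> x = 0)"
  have "\<exists>d. \<forall>n. ?P n (d n) \<and> psum (d n) (d n) (d (Suc n))"
  proof (rule dependent_nat_choice)
    show "\<exists>x. ?P 0 x" using c n by blast
    fix x n assume x: "?P n x"
    then have xc: "x \<in> carrier M" "neg x \<in> carrier M" using compl_closed by auto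
    obtain p where p: "idem p" "leq (x \<odot> p) (neg x \<odot> p)" "leq (neg x \<odot> neg p) (x \<odot> neg p)"
      using comparability[OF xc] by blast
    have "neg p = nul"
    proof (rule ccontr)
      assume "neg p \<noteq> nul"
      then obtain U where U: "ultra U" "neg p \<in> U" using ultra_exists idem_neg p(1) by metis
      obtain \<phi> where "unit_hom \<phi>" "\<phi> (neg x) \<le> \<phi> x"
        using ultra_leq_hom[OF U(1)] U(2) xc p(3) by metis
      then show False using x unit_hom_neg[OF _ xc(1)] by fastforce
    qed
    then have "p = unt" using p(1) idem_closed compl_compl compl_one one_closed by metis
    then have "leq x (neg x)" using p(2) xc mult_one_right by simp
    then obtain y where y: "psum x x y" using leq_compl_psum xc by blast
    then have "\<phi> y = 0" if "unit_hom \<phi>" for \<phi> using unit_hom_psum[OF that y] x that by simp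
    then show "\<exists>y. ?P (Suc n) y \<and> psum x x y" using y psum_closed(3)[OF y] by (intro exI[of _ y]) simp
  qed
  then obtain d where "\<forall>n. ?P n (d n) \<and> psum (d n) (d n) (d (Suc n))" by (elim exE)
  then have "psum (d n) (d n) (d (Suc n))" "d 0 = c" for n by auto
  then show False using psum_self_all_imp_zero[OF omega_complete, of d] c by simp
qed

text \<open>Off p the excess c of a over b is itself an element. If it were nonzero, some
  homomorphism would detect it; that one takes the value 1 on 1 - p and so puts a strictly above
  b.\<close>

lemma leq_if_unit_hom_le:
  assumes a: "a \<in> carrier M" and b: "b \<in> carrier M" and le: "\<And>\<phi>. unit_hom \<phi> \<Longrightarrow> \<phi> a \<le> \<phi> b"
  shows "leq a b"
proof -
  obtain p where p: "idem p" "leq (a \<odot> p) (b \<odot> p)" "leq (b \<odot> neg p) (a \<odot> neg p)"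
    using comparability[OF a b] by blast
  obtain c where c: "psum (b \<odot> neg p) c (a \<odot> neg p)" using p(3) by (auto simp: leq_def)
  have np: "idem (neg p)" "neg p \<in> carrier M" using p(1) idem_neg idem_closed by auto
  have cc: "c \<in> carrier M" using c psum_closed by blast
  have "c = nul"
  proof (rule ccontr)
    assume "c \<noteq> nul"
    then obtain \<phi> where \<phi>: "unit_hom \<phi>" "\<phi> c \<noteq> 0" using unit_hom_nonzero cc by blast
    have "\<phi> c * \<phi> (neg p) = \<phi> c"
      using psum_absorb_idem[OF c np(1) b a] unit_hom_mult[OF \<phi>(1) cc np(2)] by simp
    then have "\<phi> (neg p) = 1" using \<phi>(2) by simp
    then have "\<phi> a = \<phi> b + \<phi> c"
      using unit_hom_psum[OF \<phi>(1) c] unit_hom_mult[OF \<phi>(1)] np(2) a b by simp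
    then show False using le[OF \<phi>(1)] unit_hom_nonneg[OF \<phi>(1), of c] \<phi>(2) by linarith
  qed
  then have "leq (a \<odot> neg p) (b \<odot> neg p)"
    using c psum_zero psum_unique psum_closed leq_refl by metis
  then show ?thesis using leq_idemI[OF p(1,2) _ a b] by blast
qed

text \<open>The first n binary digits are constant near \<phi>: comparability with the complement
  tells, on an idempotent, which of the two can be doubled, and an estimate for the double is
  halved. This ties the topology to the idempotents.\<close>

lemma unit_hom_locally_close:
  assumes \<phi>: "unit_hom \<phi>" and "a \<in> carrier M"
  shows "\<exists>q. idem q \<and> \<phi> q = 1 \<and> (\<forall>\<psi>. unit_hom \<psi> \<longrightarrow> \<psi> q = 1 \<longrightarrow> \<bar>\<psi> a - \<phi> a\<bar> \<le> (1/2) ^ n)"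
  using assms(2)
proof (induction n arbitrary: a)
  case 0
  have "\<bar>\<psi> a - \<phi> a\<bar> \<le> 1" if "unit_hom \<psi>" for \<psi>
    using unit_hom_nonneg[OF that, of a] unit_hom_le_one[OF that, of a]
      unit_hom_nonneg[OF \<phi>, of a] unit_hom_le_one[OF \<phi>, of a] by linarith
  then show ?case using idem_one unit_hom_one[OF \<phi>] by auto
next
  case (Suc n)
  have step: "\<exists>q. idem q \<and> \<phi> q = 1 \<and>
      (\<forall>\<psi>. unit_hom \<psi> \<longrightarrow> \<psi> q = 1 \<longrightarrow> \<bar>\<psi> b - \<phi> b\<bar> \<le> (1/2) ^ Suc n)"
    if b: "b \<in> carrier M" and p: "idem p" "leq (b \<odot> p) (neg b \<odot> p)" "\<phi> p = 1" for b p
  proof -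
    have pc: "p \<in> carrier M" using p idem_closed by blast
    \<comment> \<open>The double need only exist on p, and a homomorphism with value 1 at p cannot
      tell \<open>b\<close> from its restriction to p.\<close>
    obtain x where x: "psum (b \<odot> p) (b \<odot> p) x"
      using psum_mono[OF split_left[OF pc b] leq_refl p(2)] b pc mult_closed by blast
    have dbl: "\<psi> x = 2 * \<psi> b" if "unit_hom \<psi>" "\<psi> p = 1" for \<psi>
      using unit_hom_psum[OF that(1) x] unit_hom_mult[OF that(1) b pc] that(2) by simp
    obtain q where q: "idem q" "\<phi> q = 1"
      "\<And>\<psi>. unit_hom \<psi> \<Longrightarrow> \<psi> q = 1 \<Longrightarrow> \<bar>\<psi> x - \<phi> x\<bar> \<le> (1/2) ^ n"
      using Suc.IH[OF psum_closed(3)[OF x]] by blast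
    have "\<bar>\<psi> b - \<phi> b\<bar> \<le> (1/2) ^ Suc n" if "unit_hom \<psi>" "\<psi> (q \<odot> p) = 1" for \<psi>
    proof -
      have "\<psi> q = 1" "\<psi> p = 1" using that unit_hom_mult_eq_one q(1) p(1) by auto
      then have "\<psi> b - \<phi> b = (\<psi> x - \<phi> x) / 2" "\<bar>\<psi> x - \<phi> x\<bar> \<le> (1/2) ^ n"
        using q(3)[OF that(1)] dbl[OF that(1)] dbl[OF \<phi> p(3)] by simp_all
      then show ?thesis using abs_half[of "\<psi> b - \<phi> b" "\<psi> x - \<phi> x"] by simp
    qed
    then show ?thesis
      using idem_mult[OF q(1) p(1)] unit_hom_mult_eq_one[OF \<phi> q(1) p(1)] q(2) p(3) by blast
  qed
  have a: "a \<in> carrier M" "neg a \<in> carrier M" using Suc.prems compl_closed by auto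
  obtain p where p: "idem p" "leq (a \<odot> p) (neg a \<odot> p)" "leq (neg a \<odot> neg p) (a \<odot> neg p)"
    using comparability[OF a] by blast
  consider "\<phi> p = 1" | "\<phi> (neg p) = 1"
    using unit_hom_idem[OF \<phi> p(1)] unit_hom_neg[OF \<phi> idem_closed[OF p(1)]] by auto
  then show ?case
  proof cases
    case 1 then show ?thesis using step[OF a(1) p(1,2)] by blast
  next
    case 2
    have "\<bar>\<psi> (neg a) - \<phi> (neg a)\<bar> = \<bar>\<psi> a - \<phi> a\<bar>" if "unit_hom \<psi>" for \<psi>
      using unit_hom_neg[OF that a(1)] unit_hom_neg[OF \<phi> a(1)] by simp
    then show ?thesis using step[OF a(2) idem_neg[OF p(1)] _ 2] p(3) compl_compl[OF a(1)] by auto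
  qed
qed

text \<open>The supremum t satisfies \<open>s n \<odot> t = s n\<close>; taking suprema on the left
  gives t t = t.\<close>

lemma lub_of_idem:
  assumes s: "\<And>n. idem (s n)" and inc: "\<And>n. leq (s n) (s (Suc n))" and t: "lub_of s t"
  shows "idem t"
proof -
  have tc: "t \<in> carrier M" using t lub_of_closed by blast
  have "s n \<odot> t = s n" for n
  proof -
    have sc: "s n \<in> carrier M" using s idem_closed by blast
    have "leq (s n) t" using t by (simp add: lub_of_def)
    then have "leq (s n \<odot> s n) (s n \<odot> t)" using sc mult_left_mono by blast
    then have "leq (s n) (s n \<odot> t)" using s[of n] by (simp add: idem_def)
    then show ?thesis using mult_leq_left[OF sc tc] leq_antisym by blast
  qed
  then have "lub_of s (t \<odot> t)" using lub_of_mult'[OF t inc tc] by simp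
  then show ?thesis using t lub_of_unique tc by (simp add: idem_def)
qed

end

section \<open>The spectrum\<close>

context omega_effect_monoid
begin

definition spectrum :: "('a \<Rightarrow> real) set" where
  "spectrum = {\<phi>. unit_hom \<phi>}"

lemma closed_spectrum: "closed spectrum"
proof -
  \<comment> \<open>The guards in \<open>unit_hom\<close> do not depend on \<phi>, so each guarded
    condition is either vacuous or one closed condition on coordinates.\<close>
  have imp: "closed {\<phi>. P \<longrightarrow> Q \<phi>}" if "P \<Longrightarrow> closed {\<phi>. Q \<phi>}"
    for P and Q :: "('a \<Rightarrow> real) \<Rightarrow> bool"
    using that by (cases P) auto
  note c = continuous_on_product_coordinates
  show ?thesis
    unfolding spectrum_def unit_hom_def Ball_def
    by (intro closed_Collect_conj closed_Collect_all imp closed_Collect_eq closed_Collect_le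
        continuous_intros c)
qed

lemma compact_spectrum: "compact spectrum"
proof -
  have "compactin (product_topology (\<lambda>_. euclideanreal) UNIV) (PiE UNIV (\<lambda>_::'a. {0..1}))"
    by (simp add: compactin_PiE)
  then have "compact (PiE UNIV (\<lambda>_::'a. {0..1::real}))"
    by (simp add: euclidean_product_topology)
  moreover have "spectrum \<subseteq> PiE UNIV (\<lambda>_. {0..1})"
    using unit_hom_nonneg unit_hom_le_one by (auto simp: spectrum_def PiE_def)
  ultimately show ?thesis
    using closed_spectrum compact_Int_closed by (metis inf.absorb2)
qed

section \<open>Clopen sets given by idempotents\<close>

definition clopen :: "'a \<Rightarrow> ('a \<Rightarrow> real) set" where
  "clopen p = {\<phi> \<in> spectrum. \<phi> p = 1}"

text \<open>Only the values 0 and 1 occur at an idempotent, so the closed condition can be replaced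
  by the open threshold 1/2.\<close>

lemma clopen_eq:
  assumes "idem p"
  shows "clopen p = spectrum \<inter> {\<phi>. 1/2 < \<phi> p}"
  using unit_hom_idem[OF _ assms] by (force simp: clopen_def spectrum_def)

lemma open_half: "open {\<phi> :: 'a \<Rightarrow> real. 1/2 < \<phi> p}"
  by (intro open_Collect_less continuous_intros continuous_on_product_coordinates)

lemma openin_clopen: "idem p \<Longrightarrow> openin (top_of_set spectrum) (clopen p)"
  using open_half clopen_eq by (simp add: openin_open_Int)

lemma closedin_clopen: "closedin (top_of_set spectrum) (clopen p)"
proof -
  have "closed {\<phi> :: 'a \<Rightarrow> real. \<phi> p = 1}"
    by (intro closed_Collect_eq continuous_intros continuous_on_product_coordinates)
  moreover have "clopen p = spectrum \<inter> {\<phi>. \<phi> p = 1}" by (auto simp: clopen_def)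
  ultimately show ?thesis by (simp add: closedin_closed_Int)
qed

lemma clopen_mult: "idem p \<Longrightarrow> idem q \<Longrightarrow> clopen (p \<odot> q) = clopen p \<inter> clopen q"
  using unit_hom_mult_eq_one by (auto simp: clopen_def spectrum_def)

lemma clopen_join: "idem p \<Longrightarrow> idem q \<Longrightarrow> clopen (join p q) = clopen p \<union> clopen q"
  using unit_hom_join_eq_one by (auto simp: clopen_def spectrum_def)

lemma clopen_mono: "leq p q \<Longrightarrow> clopen p \<subseteq> clopen q"
proof
  fix \<phi> assume "leq p q" "\<phi> \<in> clopen p"
  then show "\<phi> \<in> clopen q"
    using unit_hom_mono[of \<phi> p q] unit_hom_le_one[of \<phi> q] by (simp add: clopen_def spectrum_def)
qed

lemma clopen_zero: "clopen nul = {}"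
  by (auto simp: clopen_def spectrum_def dest: unit_hom_zero)

lemma clopen_empty:
  assumes "idem p" "clopen p = {}"
  shows "p = nul"
proof (rule ccontr)
  assume "p \<noteq> nul"
  then obtain \<phi> where "unit_hom \<phi>" "\<phi> p \<noteq> 0" using unit_hom_nonzero idem_closed assms by blast
  then have "\<phi> \<in> clopen p" using unit_hom_idem assms by (auto simp: clopen_def spectrum_def)
  then show False using assms by blast
qed

lemma clopen_coordinate:
  assumes \<phi>: "\<phi> \<in> spectrum" and V: "open V" "\<phi> a \<in> V"
  obtains q where "idem q" "\<phi> \<in> clopen q" "\<And>\<psi>. \<psi> \<in> clopen q \<Longrightarrow> \<psi> a \<in> V"
proof (cases "a \<in> carrier M")
  case True
  obtain e where e: "e > 0" "ball (\<phi> a) e \<subseteq> V" using V open_contains_ball by metis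
  obtain n where n: "(1/2::real) ^ n < e" using real_arch_pow_inv[of e "1/2"] e by auto
  obtain q where q: "idem q" "\<phi> q = 1"
    "\<And>\<psi>. unit_hom \<psi> \<Longrightarrow> \<psi> q = 1 \<Longrightarrow> \<bar>\<psi> a - \<phi> a\<bar> \<le> (1/2) ^ n"
    using unit_hom_locally_close[OF _ True] \<phi> unfolding spectrum_def by blast
  have "\<psi> a \<in> V" if "\<psi> \<in> clopen q" for \<psi>
  proof -
    have "\<bar>\<psi> a - \<phi> a\<bar> \<le> (1/2) ^ n" using q(3) that by (simp add: clopen_def spectrum_def)
    then have "\<psi> a \<in> ball (\<phi> a) e" using n by (simp add: dist_real_def abs_minus_commute)
    then show ?thesis using e by blast
  qed
  then show ?thesis using that q(1,2) \<phi> by (simp add: clopen_def)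
next
  case False
  \<comment> \<open>At a coordinate outside the carrier all homomorphisms vanish, so the whole
    spectrum, \<open>clopen unt\<close>, will do.\<close>
  then have "\<psi> a \<in> V" if "\<psi> \<in> clopen unt" for \<psi>
    using that V(2) \<phi> unit_hom_outside[of \<psi> a] unit_hom_outside[of \<phi> a] False
    by (simp add: clopen_def spectrum_def)
  moreover have "\<phi> \<in> clopen unt" using \<phi> unit_hom_one by (simp add: clopen_def spectrum_def)
  ultimately show ?thesis using that[OF idem_one] by blast
qed

text \<open>A basic box restricts finitely many coordinates; each contributes an idempotent, and
  their product gives the intersection.\<close>

lemma clopen_basis:
  assumes \<phi>: "\<phi> \<in> spectrum" and W: "open W" "\<phi> \<in> W"
  obtains q where "idem q" "\<phi> \<in> clopen q" "clopen q \<subseteq> W"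
proof -
  have "openin (product_topology (\<lambda>_. euclideanreal) UNIV) W"
    using W by (simp add: euclidean_product_topology)
  then obtain X where X: "\<phi> \<in> PiE UNIV X" "\<And>i. open (X i)" "finite {i. X i \<noteq> UNIV}"
    "PiE UNIV X \<subseteq> W"
    using product_topology_open_contains_basis[of "\<lambda>_. euclideanreal" UNIV W \<phi>] W(2) by auto
  have "\<exists>q. idem q \<and> \<phi> \<in> clopen q \<and> (\<forall>\<psi>\<in>clopen q. \<forall>i\<in>F. \<psi> i \<in> X i)" if "finite F" for F
    using that
  proof (induction F rule: finite_induct)
    case empty
    then show ?case using idem_one \<phi> unit_hom_one by (auto simp: clopen_def spectrum_def)
  next
    case (insert i F)
    then obtain q where q: "idem q" "\<phi> \<in> clopen q" "\<forall>\<psi>\<in>clopen q. \<forall>i\<in>F. \<psi> i \<in> X i" by blast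
    have "\<phi> i \<in> X i" using X(1) by auto
    then obtain r where r: "idem r" "\<phi> \<in> clopen r" "\<And>\<psi>. \<psi> \<in> clopen r \<Longrightarrow> \<psi> i \<in> X i"
      using clopen_coordinate[OF \<phi> X(2)] by metis
    then show ?case
      using q clopen_mult[OF q(1) r(1)] idem_mult[OF q(1) r(1)] by (intro exI[of _ "q \<odot> r"]) auto
  qed
  then obtain q where q: "idem q" "\<phi> \<in> clopen q" "\<forall>\<psi>\<in>clopen q. \<forall>i\<in>{i. X i \<noteq> UNIV}. \<psi> i \<in> X i"
    using X(3) by blast
  have "clopen q \<subseteq> W"
  proof
    fix \<psi> assume "\<psi> \<in> clopen q"
    then have "\<psi> i \<in> X i" for i using q(3) by (cases "X i = UNIV") auto
    then show "\<psi> \<in> W" using X(4) by auto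
  qed
  then show ?thesis using that q by blast
qed

lemma clopen_finite_union:
  assumes "finite D" "\<And>q. q \<in> D \<Longrightarrow> idem q"
  shows "\<exists>r. idem r \<and> clopen r = (\<Union>q\<in>D. clopen q)"
  using assms
proof (induction D rule: finite_induct)
  case empty
  then show ?case using idem_zero clopen_zero by (intro exI[of _ nul]) simp
next
  case (insert q D)
  then obtain r where r: "idem r" "clopen r = (\<Union>q\<in>D. clopen q)" by blast
  have q: "idem q" using insert.prems by simp
  show ?case
    using idem_join[OF q r(1)] clopen_join[OF q r(1)] r(2) by (intro exI[of _ "join q r"]) simp
qed

lemma compact_in_clopen:
  assumes K: "compact K" "K \<subseteq> S" and S: "openin (top_of_set spectrum) S"
  obtains r where "idem r" "K \<subseteq> clopen r" "clopen r \<subseteq> S"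
proof -
  let ?Q = "{q. idem q \<and> clopen q \<subseteq> S}"
  obtain W where W: "open W" "S = spectrum \<inter> W" using S by (auto simp: openin_open)
  \<comment> \<open>The covering sets are taken open in the ambient function space; on the spectrum
    they coincide with the clopen sets.\<close>
  have cover: "K \<subseteq> (\<Union>q\<in>?Q. {\<phi>. 1/2 < \<phi> q})"
  proof
    fix \<phi> assume "\<phi> \<in> K"
    then have p: "\<phi> \<in> spectrum" "\<phi> \<in> W" using K W by auto
    obtain q where q: "idem q" "\<phi> \<in> clopen q" "clopen q \<subseteq> W"
      using clopen_basis[OF p(1) W(1) p(2)] by blast
    moreover have "clopen q \<subseteq> spectrum" by (auto simp: clopen_def)
    ultimately show "\<phi> \<in> (\<Union>q\<in>?Q. {\<phi>. 1/2 < \<phi> q})" using W clopen_eq by auto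
  qed
  obtain D where D: "D \<subseteq> ?Q" "finite D" "K \<subseteq> (\<Union>q\<in>D. {\<phi>. 1/2 < \<phi> q})"
    by (rule compactE_image[OF K(1) open_half cover])
  obtain r where r: "idem r" "clopen r = (\<Union>q\<in>D. clopen q)"
    using clopen_finite_union[OF D(2)] D(1) by blast
  have "K \<subseteq> clopen r"
  proof
    fix \<phi> assume \<phi>: "\<phi> \<in> K"
    then obtain q where q: "q \<in> D" "1/2 < \<phi> q" using D(3) by auto
    have "\<phi> \<in> spectrum" "idem q" using \<phi> q(1) D(1) K(2) W by auto
    then have "\<phi> \<in> clopen q" using q(2) clopen_eq by auto
    then show "\<phi> \<in> clopen r" using r(2) q(1) by auto
  qed
  then show ?thesis using that r D(1) by blast
qed

text \<open>The supremum t gives the closure. If a basic clopen set q around a point of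
  \<open>clopen t\<close> missed every \<open>s n\<close>, then q s n = 0 for all n, and normality
  of multiplication would force q t = 0.\<close>

lemma closure_of_clopen_union:
  assumes s: "\<And>n. idem (s n)" "\<And>n. leq (s n) (s (Suc n))"
  shows "\<exists>t. idem t \<and> top_of_set spectrum closure_of (\<Union>n. clopen (s n)) = clopen t"
proof -
  obtain t where t: "lub_of s t" using lub_exists[of s] s(2) by blast
  have it: "idem t" using lub_of_idem[OF s t] .
  have "top_of_set spectrum closure_of (\<Union>n. clopen (s n)) \<subseteq> clopen t"
  proof (intro closure_of_minimal UN_least closedin_clopen)
    fix n
    have "leq (s n) t" using t by (simp add: lub_of_def)
    then show "clopen (s n) \<subseteq> clopen t" by (rule clopen_mono)
  qed
  moreover have "clopen t \<subseteq> top_of_set spectrum closure_of (\<Union>n. clopen (s n))"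
  proof
    fix \<phi> assume \<phi>: "\<phi> \<in> clopen t"
    then have sp: "\<phi> \<in> spectrum" by (simp add: clopen_def)
    have "\<exists>\<psi>. \<psi> \<in> (\<Union>n. clopen (s n)) \<and> \<psi> \<in> T"
      if T: "\<phi> \<in> T" "openin (top_of_set spectrum) T" for T
    proof (rule ccontr)
      assume n: "\<not> (\<exists>\<psi>. \<psi> \<in> (\<Union>n. clopen (s n)) \<and> \<psi> \<in> T)"
      obtain W where W: "open W" "T = spectrum \<inter> W" using T(2) by (auto simp: openin_open)
      obtain q where q: "idem q" "\<phi> \<in> clopen q" "clopen q \<subseteq> W"
        using clopen_basis[OF sp W(1)] T(1) W(2) by blast
      have "q \<odot> s n = nul" for n
      proof (rule clopen_empty)
        show "idem (q \<odot> s n)" using q s idem_mult by blast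
        show "clopen (q \<odot> s n) = {}"
          using n q(3) W(2) clopen_mult[OF q(1) s(1)] by (auto simp: clopen_def)
      qed
      then have "lub_of (\<lambda>n. nul) (q \<odot> t)"
        using lub_of_mult[OF t s(2) idem_closed[OF q(1)]] by simp
      then have "q \<odot> t = nul" using lub_of_unique lub_of_const zero_closed by blast
      moreover have "\<phi> \<in> clopen (q \<odot> t)" using \<phi> q clopen_mult it by blast
      ultimately show False using clopen_zero by simp
    qed
    then show "\<phi> \<in> top_of_set spectrum closure_of (\<Union>n. clopen (s n))"
      using sp by (simp add: in_closure_of)
  qed
  ultimately show ?thesis using it by blast
qed

text \<open>A cozero set is the union of the compact sets where the function is bounded away from 0;
  each of these is enclosed in a clopen subset of it.\<close>

lemma spectrum_basically_disconnected: "basically_disconnected_space (top_of_set spectrum)"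
  unfolding basically_disconnected_space_def
proof (intro allI impI)
  fix S assume "cozero_set_in (top_of_set spectrum) S"
  then obtain h where h: "continuous_on spectrum h" "S = {\<phi> \<in> spectrum. h \<phi> \<noteq> (0::real)}"
    by (auto simp: cozero_set_in_def)
  have "S = spectrum \<inter> h -` (- {0})" using h(2) by auto
  then have So: "openin (top_of_set spectrum) S"
    using continuous_openin_preimage_gen[OF h(1), of "- {0}"] by (simp add: open_Compl)
  define K where "K n = {\<phi> \<in> spectrum. 1 / real (Suc n) \<le> \<bar>h \<phi>\<bar>}" for n
  have Kc: "compact (K n)" for n
  proof -
    have "K n = spectrum \<inter> (\<lambda>\<phi>. \<bar>h \<phi>\<bar>) -` {1 / real (Suc n)..}" by (auto simp: K_def)
    moreover have "closedin (top_of_set spectrum) (spectrum \<inter> (\<lambda>\<phi>. \<bar>h \<phi>\<bar>) -` {1 / real (Suc n)..})"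
      by (intro continuous_closedin_preimage continuous_intros h(1))
    ultimately show ?thesis using closedin_compact compact_spectrum by metis
  qed
  have KS: "K n \<subseteq> S" for n using h(2) by (auto simp: K_def)
  have "\<exists>r. idem r \<and> K n \<subseteq> clopen r \<and> clopen r \<subseteq> S" for n
    using compact_in_clopen[OF Kc KS So] by metis
  then obtain r where r: "\<And>n. idem (r n)" "\<And>n. K n \<subseteq> clopen (r n)" "\<And>n. clopen (r n) \<subseteq> S" by metis
  \<comment> \<open>Successive joins make the enclosing clopen sets increasing, so that their
    idempotents have a supremum.\<close>
  define s where "s = rec_nat (r 0) (\<lambda>n x. join x (r (Suc n)))"
  have s0: "s 0 = r 0" and sS: "s (Suc n) = join (s n) (r (Suc n))" for n by (simp_all add: s_def)
  have s: "idem (s n)" "clopen (s n) \<subseteq> S" "K n \<subseteq> clopen (s n)" for n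
  proof -
    have "idem (s n) \<and> clopen (s n) \<subseteq> S"
      by (induction n) (use r in \<open>auto simp: s0 sS idem_join clopen_join\<close>)
    then show i: "idem (s n)" "clopen (s n) \<subseteq> S" for n
      by (induction n) (use r in \<open>auto simp: s0 sS idem_join clopen_join\<close>)
    show "K n \<subseteq> clopen (s n)" using r i by (cases n) (auto simp: s0 sS clopen_join)
  qed
  have "S \<subseteq> (\<Union>n. clopen (s n))"
  proof
    fix \<phi> assume "\<phi> \<in> S"
    then have "\<phi> \<in> spectrum" "0 < \<bar>h \<phi>\<bar>" using h(2) by auto
    moreover obtain n where "inverse (real (Suc n)) < \<bar>h \<phi>\<bar>"
      using reals_Archimedean[OF calculation(2)] by blast
    ultimately have "\<phi> \<in> K n" by (simp add: K_def inverse_eq_divide)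
    then show "\<phi> \<in> (\<Union>n. clopen (s n))" using s(3) by blast
  qed
  then have SU: "S = (\<Union>n. clopen (s n))" using s(2) by blast
  have "leq (s n) (s (Suc n))" for n unfolding sS using leq_join s(1) r(1) by blast
  then show "openin (top_of_set spectrum) (top_of_set spectrum closure_of S)"
    using closure_of_clopen_union[of s] s(1) openin_clopen unfolding SU by metis
qed

end

section \<open>Transport along homeomorphisms, the one-point Boolean algebra and the
  embedding\<close>

lemma basically_disconnected_homeomorphic:
  assumes f: "homeomorphic_map Y X f" and Y: "basically_disconnected_space Y"
  shows "basically_disconnected_space X"
  unfolding basically_disconnected_space_def
proof (intro allI impI)
  fix S assume "cozero_set_in X S"
  then obtain h where h: "continuous_map X euclideanreal h" "S = {x \<in> topspace X. h x \<noteq> 0}"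
    by (auto simp: cozero_set_in_def)
  define S' where "S' = {y \<in> topspace Y. (h \<circ> f) y \<noteq> 0}"
  have "continuous_map Y euclideanreal (h \<circ> f)"
    using f h(1) homeomorphic_imp_continuous_map continuous_map_compose by blast
  then have o: "openin Y (Y closure_of S')"
    using Y unfolding basically_disconnected_space_def cozero_set_in_def S'_def by blast
  have "S = f ` S'"
    using homeomorphic_imp_surjective_map[OF f] by (auto simp: h(2) S'_def)
  then have "X closure_of S = f ` (Y closure_of S')"
    using homeomorphic_map_closure_of[OF f, of S'] by (simp add: S'_def)
  then show "openin X (X closure_of S)"
    using homeomorphic_map_openness[OF f closure_of_subset_topspace] o by simp
qed

text \<open>The degenerate Boolean algebra with 0 = 1, which serves as the trivial summand.\<close>

definition point_order :: "'c \<Rightarrow> 'c gorder" where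
  "point_order u = \<lparr>carrier = {u}, eq = (=), le = (=)\<rparr>"

lemma boolean_lattice_point: "boolean_lattice (point_order u)"
proof -
  have c: "carrier (point_order u) = {u}" by (simp add: point_order_def)
  have l: "least (point_order u) x A \<longleftrightarrow> x = u" "greatest (point_order u) x A \<longleftrightarrow> x = u" if "A = {u}" for x A
    using that by (auto simp: least_def greatest_def point_order_def)
  have U: "Upper (point_order u) A = {u}" "Lower (point_order u) A = {u}" if "A \<subseteq> {u}" for A
    using that by (auto simp: Upper_def Lower_def point_order_def)
  have m: "u \<sqinter>\<^bsub>point_order u\<^esub> u = u" "u \<squnion>\<^bsub>point_order u\<^esub> u = u"
    "\<bottom>\<^bsub>point_order u\<^esub> = u" "\<top>\<^bsub>point_order u\<^esub> = u"
    by (simp_all add: meet_def join_def sup_def inf_def bottom_def top_def l U c)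
  show ?thesis
    by unfold_locales
      (auto simp: c m is_complement_def l U, auto simp: point_order_def)
qed

lemma (in effect_algebra) omega_complete_point:
  assumes "carrier E = {u}"
  shows "omega_complete E"
proof -
  have "is_lub (effect_order E) u (range a)" if "\<And>n. a n \<in> carrier E" for a :: "nat \<Rightarrow> 'a"
    using that leq_refl effect_order_leq assms
    by (auto simp: least_def Upper_def) (auto simp: effect_order_def assms)
  then show ?thesis unfolding omega_complete_def by blast
qed

theorem theorem67:
  fixes M :: "('a, 'm) effect_monoid_scheme"
  assumes "effect_monoid M" and "omega_complete M"
  shows "\<exists>(X :: (('a \<Rightarrow> 'a) \<Rightarrow> real) topology) (B :: ('a \<Rightarrow> 'a) gorder) f.
    compact_space X \<and> Hausdorff_space X \<and> basically_disconnected_space X \<and>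
    boolean_lattice B \<and> omega_complete (boolean_effect_monoid B) \<and>
    effect_monoid_embedding M (direct_sum (unit_interval_C X) (boolean_effect_monoid B)) f"
proof -
  interpret omega_effect_monoid M
    using assms by (simp add: omega_effect_monoid_def omega_effect_monoid_axioms_def)
  \<comment> \<open>\<open>\<iota>\<close> only moves the spectrum to the prescribed type; it is inverted on constant functions.\<close>
  define \<iota> :: "('a \<Rightarrow> real) \<Rightarrow> (('a \<Rightarrow> 'a) \<Rightarrow> real)" where "\<iota> \<phi> = (\<lambda>g. \<phi> (g undefined))" for \<phi>
  define X where "X = top_of_set (\<iota> ` spectrum)"
  have top: "topspace X = \<iota> ` spectrum" by (simp add: X_def)
  have ev: "continuous_map X euclideanreal (\<lambda>F. F (\<lambda>_. a))" for a
    by (simp add: X_def continuous_on_subset[OF continuous_on_product_coordinates subset_UNIV])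
  have "homeomorphic_maps (top_of_set spectrum) X \<iota> (\<lambda>F a. F (\<lambda>_. a))"
    unfolding homeomorphic_maps_def X_def \<iota>_def
    by (auto intro!: continuous_on_coordinatewise_then_product
        continuous_on_subset[OF continuous_on_product_coordinates subset_UNIV])
  then have hom: "homeomorphic_map (top_of_set spectrum) X \<iota>" by (rule homeomorphic_maps_imp_map)
  then have hs: "top_of_set spectrum homeomorphic_space X" by (rule homeomorphic_map_imp_homeomorphic_space)
  have compact: "compact_space X"
    using homeomorphic_compact_space[OF hs] compact_spectrum
    by (simp add: compact_space_subtopology compactin_euclidean_iff)
  have "Hausdorff_space (euclidean :: ('a \<Rightarrow> real) topology)"
    using Hausdorff_space_product_topology[of "\<lambda>_::'a. euclideanreal" UNIV]
    by (simp add: euclidean_product_topology)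
  then have Hausdorff: "Hausdorff_space X"
    using homeomorphic_Hausdorff_space[OF hs] Hausdorff_space_subtopology by blast
  have bd: "basically_disconnected_space X"
    using basically_disconnected_homeomorphic[OF hom spectrum_basically_disconnected] .
  define u :: "'a \<Rightarrow> 'a" where "u = undefined"
  let ?B = "boolean_effect_monoid (point_order u)"
  have bl: "boolean_lattice (point_order u)" by (rule boolean_lattice_point)
  interpret B: effect_monoid ?B using boolean_lattice.boolean_effect_monoid[OF bl] .
  have cB: "carrier ?B = {u}" by (simp add: boolean_effect_monoid_def point_order_def)
  have B: "eone ?B = u" "eplus ?B u u = Some u" "emult ?B u u = u"
    using B.one_closed B.zero_closed B.mult_closed[of u u] B.plus_zero[of u] cB by auto
  let ?C = "unit_interval_C X"
  have C: "eone ?C = (\<lambda>x\<in>topspace X. 1)"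
    "\<And>f g. eplus ?C f g = (if \<forall>x\<in>topspace X. f x + g x \<le> 1
       then Some (\<lambda>x\<in>topspace X. f x + g x) else None)"
    "\<And>f g. emult ?C f g = (\<lambda>x\<in>topspace X. f x * g x)"
    by (auto simp: unit_interval_C_def eone_def fun_eq_iff)
  \<comment> \<open>The Gelfand transform of \<open>a\<close>: after \<iota>, the coordinate
    \<open>a\<close> of a homomorphism is found at the constant function with value
    \<open>a\<close>.\<close>
  define e where "e a = (\<lambda>F\<in>topspace X. F (\<lambda>_. a))" for a
  have e\<iota>: "e a (\<iota> \<phi>) = \<phi> a" if "\<phi> \<in> spectrum" for a \<phi>
    using that by (simp add: e_def top \<iota>_def)
  let ?f = "\<lambda>a. (e a, u)"
  have "effect_monoid_embedding M (direct_sum ?C ?B) ?f"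
  proof
    fix a assume a: "a \<in> carrier M"
    have "e a \<in> carrier ?C"
      unfolding unit_interval_C_carrier e_def
      using continuous_map_restrict_topspace[OF ev] unit_hom_nonneg unit_hom_le_one
      by (auto simp: top \<iota>_def spectrum_def)
    then show "?f a \<in> carrier (direct_sum ?C ?B)" by (simp add: direct_sum_def cB)
  next
    have "e unt = eone ?C"
      using unit_hom_one by (auto simp: C e_def top \<iota>_def spectrum_def fun_eq_iff restrict_def)
    then show "?f unt = eone (direct_sum ?C ?B)"
      using B(1) by (simp add: direct_sum_def eone_def)
  next
    fix a b c assume "a \<in> carrier M" "b \<in> carrier M" "eplus M a b = Some c"
    then have "\<phi> c = \<phi> a + \<phi> b" "\<phi> c \<le> 1" if "\<phi> \<in> spectrum" for \<phi>
      using that unit_hom_psum unit_hom_le_one by (auto simp: spectrum_def psum_def)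
    then have "eplus ?C (e a) (e b) = Some (e c)"
      by (auto simp: C top e\<iota> intro!: restrict_ext) (auto simp: e_def top \<iota>_def restrict_def fun_eq_iff)
    then show "eplus (direct_sum ?C ?B) (?f a) (?f b) = Some (?f c)"
      by (simp add: direct_sum_def B)
  next
    fix a b assume "a \<in> carrier M" "b \<in> carrier M"
    then have "\<phi> (a \<odot> b) = \<phi> a * \<phi> b" if "\<phi> \<in> spectrum" for \<phi>
      using that unit_hom_mult by (auto simp: spectrum_def)
    then have "e (a \<odot> b) = emult ?C (e a) (e b)"
      by (auto simp: C e_def top \<iota>_def restrict_def fun_eq_iff)
    then show "?f (a \<odot> b) = emult (direct_sum ?C ?B) (?f a) (?f b)"
      by (simp add: direct_sum_def B)
  next
    fix a b assume ab: "a \<in> carrier M" "b \<in> carrier M" and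
      "?f a \<sqsubseteq>\<^bsub>effect_order (direct_sum ?C ?B)\<^esub> ?f b"
    then obtain g where g: "g \<in> carrier ?C" "eplus ?C (e a) g = Some (e b)"
      by (auto simp: effect_order_def direct_sum_def split: option.splits)
    \<comment> \<open>The difference \<open>g\<close> of the two transforms is nonnegative at each
      point, and the points are all the homomorphisms; these determine the order.\<close>
    have "\<phi> a \<le> \<phi> b" if "unit_hom \<phi>" for \<phi>
    proof -
      have \<phi>: "\<phi> \<in> spectrum" using that by (simp add: spectrum_def)
      have "e b = (\<lambda>x\<in>topspace X. e a x + g x)" using g(2) by (simp add: C split: if_splits)
      then have "\<phi> b = \<phi> a + g (\<iota> \<phi>)" using e\<iota>[OF \<phi>] \<phi> by (metis imageI restrict_apply' top)
      moreover have "0 \<le> g (\<iota> \<phi>)" using g(1) \<phi> by (auto simp: unit_interval_C_carrier top)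
      ultimately show ?thesis by simp
    qed
    then have "leq a b" using leq_if_unit_hom_le ab by blast
    then show "a \<sqsubseteq>\<^bsub>effect_order M\<^esub> b" using effect_order_leq ab by blast
  qed
  moreover have "omega_complete ?B" using B.omega_complete_point[OF cB] .
  ultimately show ?thesis using compact Hausdorff bd bl by blast
qed

end
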